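(* Suppose there exist $\mu_j>0$, $j\in\mathcal J$, such that $\mu_{ij}=\mu_j$ for all $(ij)\in\mathcal E$. Then the system is globally stable both for $\rho<1$ and for $\rho=1$. In addition, the system is locally stable as well (i.e., the matrices $A_u$ (case $\rho<1$) and $A_c$ (case $\rho=1$) are stable).
   Context: Model. Customer types $i\in\mathcal I$, $|\mathcal I|=I$; server pools $j\in\mathcal J$, $|\mathcal J|=J$ (finite). Parameters: $\lambda_i>0$, $\beta_j>0$, $\mu_{ij}\ge 0$ ($\mu_{ij}=0$ means pool $j$ cannot serve type $i$). Static planning problem (SPP): minimize $\rho$ over $(\lambda_{ij}),\rho$ subject to $\lambda_{ij}\ge0$, $\sum_j\lambda_{ij}=\lambda_i$ for all $i$, and $\sum_i\lambda_{ij}/(\beta_j\mu_{ij})\le\rho$ for all $j$. Standing assumption (complete resource pooling): the SPP has a unique optimal solution $(\lambda_{ij}),\rho$, and the set of basic activities $\mathcal E=\{(ij):\lambda_{ij}>0\}$ is the edge set of a (connected) tree on the vertex set $\mathcal I\cup\mathcal J$. Only activities in $\mathcal E$ are used. $\mathcal S(i)=\{j:(ij)\in\mathcal E\}$, $\mathcal C(j)=\{i:(ij)\in\mathcal E\}$. $\psi^*_{ij}=\lambda_{ij}/\mu_{ij}$ for $(ij)\in\mathcal E$. $\sum_i\xi_{ij}$ means $\sum_{i\in\mathcal C(j)}$, $\sum_j\xi_{ij}$ means $\sum_{j\in\mathcal S(i)}$. Fluid model. A set of Lipschitz continuous functions of $t\ge 0$, $\{(a_i),(x_i),(q_i),(\psi_{ij})_{(ij)\in\mathcal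 E},(\rho_j)\}$ (with $q_i,\psi_{ij}\ge0$, $\rho_j\le 1$) such that for all $t\ge0$: $a_i(t)=\lambda_it$; $x_i(t)=q_i(t)+\sum_j\psi_{ij}(t)$; $x_i(t)=x_i(0)+a_i(t)-\sum_j\int_0^t\mu_{ij}\psi_{ij}(s)\,ds$; $\rho_j(t)=\frac1{\beta_j}\sum_i\psi_{ij}(t)$; $\rho_j(t)=1$ if $q_i(t)>0$ for some $i\in\mathcal C(j)$; and, at all regular points $t$ (where the derivatives in question exist): (a) for any $\mathcal J^*\subseteq\mathcal J$ and any $\mathcal I^*\subseteq\mathcal I$ such that $q_i(t)>0$ for all $i\in\mathcal I^*$, and $q_i(t)>q_{i'}(t)$ whenever $i\in\mathcal I^*$, $i'\notin\mathcal I^*$, $\mathcal S(i)\cap\mathcal S(i')\cap\mathcal J^*\ne\varnothing$, $$\sum_{i\in\mathcal I^*}\sum_{j\in\mathcal S(i)\cap\mathcal J^*}\dot\psi_{ij}(t)=\sum_{j\in\bigcup_{i\in\mathcal I^*}\mathcal S(i)\cap\mathcal J^*}\ \sum_{i'\in\mathcal C(j)}\mu_{i'j}\psi_{i'j}(t)-\sum_{i\in\mathcal I^*}\sum_{j\in\mathcal S(i)\cap\mathcal J^*}\mu_{ij}\psi_{ij}(t);$$ (b) for any $\mathcal I_*\subseteq\mathcal I$ and any $\mathcal J_*\subseteq\mathcal J$ such that $\rho_j(t)<1$ for all $j\in\mathcal J_*$, and $\rho_j(t)<\rho_{j'}(t)$ whenever $j\in\mathcal J_*$, $j'\notin\mathcal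 J_*$, $\mathcal C(j)\cap\mathcal C(j')\cap\mathcal I_*\ne\varnothing$, $$\sum_{j\in\mathcal J_*}\sum_{i\in\mathcal C(j)\cap\mathcal I_*}\dot\psi_{ij}(t)=\sum_{i\in\bigcup_{j\in\mathcal J_*}\mathcal C(j)\cap\mathcal I_*}\lambda_i-\sum_{j\in\mathcal J_*}\sum_{i\in\mathcal C(j)\cap\mathcal I_*}\mu_{ij}\psi_{ij}(t).$$ Global stability. Equilibrium points: for $\rho<1$, $\psi_{ij}=\psi_{ij}^*$ and $q_i=0$ for all $i$; for $\rho=1$, $\psi_{ij}=\psi^*_{ij}$ and $q_i=q$ for all $i$, for some constant $q\ge0$. The system is globally stable if any fluid model, with arbitrary initial state, converges to an equilibrium point as $t\to\infty$ (so $\rho_j(t)\to\rho$, $\psi_{ij}(t)\to\psi_{ij}^*$, and $q_i(t)\to0$ for all $i$ if $\rho<1$, while $q_i(t)\to q$ for all $i$ and some $q\ge0$ if $\rho=1$). Local stability. For $y\in\mathbb R^I$ let $z=My\in\mathbb R^{\mathcal E}$ be the unique solution of $\sum_iz_{ij}=\eta\beta_j$ for all $j$ and $\sum_jz_{ij}=y_i$ for all $i$, where $\eta=\sum_iy_i/\sum_j\beta_j$. $A_u$ is the $I\times I$ matrix of $y\mapsto\big(-\sum_{j\in\mathcal S(i)}\mu_{ij}(My)_{ij}\big)_{i}$, and $(A_c)_{ii'}=(A_u)_{ii'}-\frac1I\sum_k(A_u)_{ki'}$. (These govern the fluid model near equilibrium for $\rho<1$, and for $\rho=1$ with equal positive queues,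 respectively.) $A_u$ is stable if all its eigenvalues have negative real part; $A_c$ is stable if all its eigenvalues have negative real part except one simple eigenvalue $0$. Local stability of the system is understood as stability of $A_u$ if $\rho<1$ and of $A_c$ if $\rho=1$. *)

theory Defs
  imports "HOL-Analysis.Analysis" "HOL-Computational_Algebra.Polynomial"
begin

text \<open>
  Customer types are the elements of a finite type \<open>'i\<close>, server pools those of a finite type \<open>'j\<close>.
  Throughout, \<open>lam\<close> are the arrival rates, \<open>bet\<close> the pool sizes, \<open>mu\<close> the service rates, and
  \<open>(l, rho)\<close> the solution of the static planning problem.
\<close>

section \<open>Static planning problem and complete resource pooling\<close>

text \<open>
  \<open>mu i j = 0\<close> means that pool \<open>j\<close> cannot serve type \<open>i\<close>, i.e. \<open>l i j / (bet j * mu i j)\<close> is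
  read as infinite for \<open>l i j > 0\<close>. As HOL has \<open>x / 0 = 0\<close>, the resulting constraint
  \<open>l i j = 0\<close> has to be written out.
\<close>
definition spp_feasible ::
    "('i::finite \<Rightarrow> real) \<Rightarrow> ('j::finite \<Rightarrow> real) \<Rightarrow> ('i \<Rightarrow> 'j \<Rightarrow> real) \<Rightarrow> ('i \<Rightarrow> 'j \<Rightarrow> real) \<Rightarrow> real \<Rightarrow> bool"
  where
  "spp_feasible lam bet mu l r \<longleftrightarrow>
     (\<forall>i j. 0 \<le> l i j) \<and>
     (\<forall>i j. mu i j = 0 \<longrightarrow> l i j = 0) \<and>
     (\<forall>i. (\<Sum>j\<in>UNIV. l i j) = lam i) \<and>
     (\<forall>j. (\<Sum>i\<in>UNIV. l i j / (bet j * mu i j)) \<le> r)"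

definition spp_optimal ::
    "('i::finite \<Rightarrow> real) \<Rightarrow> ('j::finite \<Rightarrow> real) \<Rightarrow> ('i \<Rightarrow> 'j \<Rightarrow> real) \<Rightarrow> ('i \<Rightarrow> 'j \<Rightarrow> real) \<Rightarrow> real \<Rightarrow> bool"
  where
  "spp_optimal lam bet mu l r \<longleftrightarrow>
     spp_feasible lam bet mu l r \<and> (\<forall>l' r'. spp_feasible lam bet mu l' r' \<longrightarrow> r \<le> r')"

definition basic_activities :: "('i \<Rightarrow> 'j \<Rightarrow> real) \<Rightarrow> ('i \<times> 'j) set" where
  "basic_activities l = {(i, j). 0 < l i j}"

definition activity_adj :: "('i \<times> 'j) set \<Rightarrow> ('i + 'j) rel" where
  "activity_adj E = {(Inl i, Inr j) | i j. (i, j) \<in> E} \<union> {(Inr j, Inl i) | i j. (i, j) \<in> E}"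

text \<open>
  \<open>R\<close> is the symmetric and irreflexive adjacency relation of an undirected simple graph whose
  vertices are all elements of the type.
\<close>
definition tree_graph :: "'v rel \<Rightarrow> bool" where
  "tree_graph R \<longleftrightarrow>
     (\<forall>u v. (u, v) \<in> R\<^sup>*) \<and>
     (\<nexists>vs. 3 \<le> length vs \<and> distinct vs \<and>
        (\<forall>k < length vs. (vs ! k, vs ! ((k + 1) mod length vs)) \<in> R))"

definition complete_resource_pooling ::
    "('i::finite \<Rightarrow> real) \<Rightarrow> ('j::finite \<Rightarrow> real) \<Rightarrow> ('i \<Rightarrow> 'j \<Rightarrow> real) \<Rightarrow> ('i \<Rightarrow> 'j \<Rightarrow> real) \<Rightarrow> real \<Rightarrow> bool"
  where
  "complete_resource_pooling lam bet mu l rho \<longleftrightarrow>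
     spp_optimal lam bet mu l rho \<and>
     (\<forall>l' r'. spp_optimal lam bet mu l' r' \<longrightarrow> l' = l \<and> r' = rho) \<and>
     tree_graph (activity_adj (basic_activities l))"

definition pools_of :: "('i \<times> 'j) set \<Rightarrow> 'i \<Rightarrow> 'j set" where
  "pools_of E i = {j. (i, j) \<in> E}"

definition types_of :: "('i \<times> 'j) set \<Rightarrow> 'j \<Rightarrow> 'i set" where
  "types_of E j = {i. (i, j) \<in> E}"

section \<open>Fluid models\<close>

text \<open>
  Functions of time are functions on the reals of which only the values at \<open>t \<ge> 0\<close> matter, and
  \<open>psi i j\<close> matters only for \<open>(i, j) \<in> E\<close>. If all these \<open>psi i j\<close> have a derivative at \<open>t > 0\<close>,
  then so do all other components of a fluid model.
\<close>
definition regular_point :: "('i \<times> 'j) set \<Rightarrow> ('i \<Rightarrow> 'j \<Rightarrow> real \<Rightarrow> real) \<Rightarrow> real \<Rightarrow> bool" where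
  "regular_point E psi t \<longleftrightarrow> 0 < t \<and> (\<forall>(i, j)\<in>E. psi i j differentiable at t)"

definition busy_pools_rule ::
    "('i::finite \<times> 'j::finite) set \<Rightarrow> ('i \<Rightarrow> 'j \<Rightarrow> real) \<Rightarrow>
     ('i \<Rightarrow> real \<Rightarrow> real) \<Rightarrow> ('i \<Rightarrow> 'j \<Rightarrow> real \<Rightarrow> real) \<Rightarrow> real \<Rightarrow> bool" where
  "busy_pools_rule E mu q psi t \<longleftrightarrow>
     (\<forall>Js Is.
        (\<forall>i\<in>Is. 0 < q i t) \<and>
        (\<forall>i\<in>Is. \<forall>i'. i' \<notin> Is \<and> pools_of E i \<inter> pools_of E i' \<inter> Js \<noteq> {} \<longrightarrow> q i' t < q i t) \<longrightarrow>
        (\<Sum>i\<in>Is. \<Sum>j\<in>pools_of E i \<inter> Js. deriv (psi i j) t) =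
          (\<Sum>j\<in>(\<Union>i\<in>Is. pools_of E i \<inter> Js). \<Sum>i'\<in>types_of E j. mu i' j * psi i' j t)
          - (\<Sum>i\<in>Is. \<Sum>j\<in>pools_of E i \<inter> Js. mu i j * psi i j t))"

definition idle_pools_rule ::
    "('i::finite \<times> 'j::finite) set \<Rightarrow> ('i \<Rightarrow> real) \<Rightarrow> ('i \<Rightarrow> 'j \<Rightarrow> real) \<Rightarrow>
     ('i \<Rightarrow> 'j \<Rightarrow> real \<Rightarrow> real) \<Rightarrow> ('j \<Rightarrow> real \<Rightarrow> real) \<Rightarrow> real \<Rightarrow> bool" where
  "idle_pools_rule E lam mu psi load t \<longleftrightarrow>
     (\<forall>Is Js.
        (\<forall>j\<in>Js. load j t < 1) \<and>
        (\<forall>j\<in>Js. \<forall>j'. j' \<notin> Js \<and> types_of E j \<inter> types_of E j' \<inter> Is \<noteq> {} \<longrightarrow> load j t < load j' t) \<longrightarrow>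
        (\<Sum>j\<in>Js. \<Sum>i\<in>types_of E j \<inter> Is. deriv (psi i j) t) =
          (\<Sum>i\<in>(\<Union>j\<in>Js. types_of E j \<inter> Is). lam i)
          - (\<Sum>j\<in>Js. \<Sum>i\<in>types_of E j \<inter> Is. mu i j * psi i j t))"

text \<open>\<open>load j\<close> is the instantaneous load of pool \<open>j\<close>, i.e. the component \<open>\<rho>\<^sub>j\<close> of the fluid model.\<close>
definition fluid_model ::
    "('i::finite \<times> 'j::finite) set \<Rightarrow> ('i \<Rightarrow> real) \<Rightarrow> ('j \<Rightarrow> real) \<Rightarrow> ('i \<Rightarrow> 'j \<Rightarrow> real) \<Rightarrow>
     ('i \<Rightarrow> real \<Rightarrow> real) \<Rightarrow> ('i \<Rightarrow> real \<Rightarrow> real) \<Rightarrow> ('i \<Rightarrow> real \<Rightarrow> real) \<Rightarrow>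
     ('i \<Rightarrow> 'j \<Rightarrow> real \<Rightarrow> real) \<Rightarrow> ('j \<Rightarrow> real \<Rightarrow> real) \<Rightarrow> bool" where
  "fluid_model E lam bet mu a x q psi load \<longleftrightarrow>
     (\<forall>i. (\<exists>L. L-lipschitz_on {0..} (a i)) \<and>
          (\<exists>L. L-lipschitz_on {0..} (x i)) \<and>
          (\<exists>L. L-lipschitz_on {0..} (q i))) \<and>
     (\<forall>(i, j)\<in>E. \<exists>L. L-lipschitz_on {0..} (psi i j)) \<and>
     (\<forall>j. \<exists>L. L-lipschitz_on {0..} (load j)) \<and>
     (\<forall>t\<ge>0.
        (\<forall>i. 0 \<le> q i t) \<and>
        (\<forall>(i, j)\<in>E. 0 \<le> psi i j t) \<and>
        (\<forall>j. load j t \<le> 1) \<and>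
        (\<forall>i. a i t = lam i * t) \<and>
        (\<forall>i. x i t = q i t + (\<Sum>j\<in>pools_of E i. psi i j t)) \<and>
        (\<forall>i. x i t = x i 0 + a i t - (\<Sum>j\<in>pools_of E i. integral {0..t} (\<lambda>s. mu i j * psi i j s))) \<and>
        (\<forall>j. load j t = 1 / bet j * (\<Sum>i\<in>types_of E j. psi i j t)) \<and>
        (\<forall>j. (\<exists>i\<in>types_of E j. 0 < q i t) \<longrightarrow> load j t = 1)) \<and>
     (\<forall>t. regular_point E psi t \<longrightarrow>
        busy_pools_rule E mu q psi t \<and> idle_pools_rule E lam mu psi load t)"

section \<open>Global stability\<close>

definition equilibrium_point ::
    "('i \<Rightarrow> 'j \<Rightarrow> real) \<Rightarrow> ('i \<Rightarrow> 'j \<Rightarrow> real) \<Rightarrow> real \<Rightarrow> ('i \<Rightarrow> real) \<Rightarrow> ('i \<Rightarrow> 'j \<Rightarrow> real) \<Rightarrow> bool" where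
  "equilibrium_point mu l rho q psi \<longleftrightarrow>
     (\<forall>(i, j)\<in>basic_activities l. psi i j = l i j / mu i j) \<and>
     (rho < 1 \<and> (\<forall>i. q i = 0) \<or> rho = 1 \<and> (\<exists>c\<ge>0. \<forall>i. q i = c))"

definition globally_stable ::
    "('i::finite \<Rightarrow> real) \<Rightarrow> ('j::finite \<Rightarrow> real) \<Rightarrow> ('i \<Rightarrow> 'j \<Rightarrow> real) \<Rightarrow> ('i \<Rightarrow> 'j \<Rightarrow> real) \<Rightarrow> real \<Rightarrow> bool"
  where
  "globally_stable lam bet mu l rho \<longleftrightarrow>
     (\<forall>a x q psi load.
        fluid_model (basic_activities l) lam bet mu a x q psi load \<longrightarrow>
        (\<exists>q_eq psi_eq. equilibrium_point mu l rho q_eq psi_eq \<and>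
           (\<forall>i. (q i \<longlongrightarrow> q_eq i) at_top) \<and>
           (\<forall>(i, j)\<in>basic_activities l. (psi i j \<longlongrightarrow> psi_eq i j) at_top) \<and>
           (\<forall>j. (load j \<longlongrightarrow> rho) at_top)))"

section \<open>Local stability\<close>

text \<open>Vectors indexed by \<open>E\<close> are represented by functions that vanish outside \<open>E\<close>.\<close>
definition occupancy_map ::
    "('i::finite \<times> 'j::finite) set \<Rightarrow> ('j \<Rightarrow> real) \<Rightarrow> real ^ 'i \<Rightarrow> 'i \<Rightarrow> 'j \<Rightarrow> real" where
  "occupancy_map E bet y =
     (THE z. (\<forall>i j. (i, j) \<notin> E \<longrightarrow> z i j = 0) \<and>
        (\<forall>j. (\<Sum>i\<in>types_of E j. z i j) = (\<Sum>i\<in>UNIV. y $ i) / (\<Sum>j'\<in>UNIV. bet j') * bet j) \<and>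
        (\<forall>i. (\<Sum>j\<in>pools_of E i. z i j) = y $ i))"

definition underload_matrix ::
    "('i::finite \<times> 'j::finite) set \<Rightarrow> ('j \<Rightarrow> real) \<Rightarrow> ('i \<Rightarrow> 'j \<Rightarrow> real) \<Rightarrow> real ^ 'i ^ 'i" where
  "underload_matrix E bet mu =
     matrix (\<lambda>y. \<chi> i. - (\<Sum>j\<in>pools_of E i. mu i j * occupancy_map E bet y i j))"

definition critical_matrix ::
    "('i::finite \<times> 'j::finite) set \<Rightarrow> ('j \<Rightarrow> real) \<Rightarrow> ('i \<Rightarrow> 'j \<Rightarrow> real) \<Rightarrow> real ^ 'i ^ 'i" where
  "critical_matrix E bet mu =
     (\<chi> i i'. underload_matrix E bet mu $ i $ i'
        - 1 / real CARD('i) * (\<Sum>k\<in>UNIV. underload_matrix E bet mu $ k $ i'))"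

definition complex_eigenvalue :: "real ^ 'n::finite ^ 'n \<Rightarrow> complex \<Rightarrow> bool" where
  "complex_eigenvalue A z \<longleftrightarrow>
     (\<exists>v :: complex ^ 'n. v \<noteq> 0 \<and> (\<chi> i k. complex_of_real (A $ i $ k)) *v v = z *s v)"

definition characteristic_poly :: "real ^ 'n::finite ^ 'n \<Rightarrow> complex poly" where
  "characteristic_poly A = det (mat [:0, 1:] - (\<chi> i k. [:complex_of_real (A $ i $ k):]))"

definition underload_stable :: "real ^ 'n::finite ^ 'n \<Rightarrow> bool" where
  "underload_stable A \<longleftrightarrow> (\<forall>z. complex_eigenvalue A z \<longrightarrow> Re z < 0)"

text \<open>Simple means of algebraic multiplicity one.\<close>
definition critical_stable :: "real ^ 'n::finite ^ 'n \<Rightarrow> bool" where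
  "critical_stable A \<longleftrightarrow>
     complex_eigenvalue A 0 \<and> order 0 (characteristic_poly A) = 1 \<and>
     (\<forall>z. complex_eigenvalue A z \<and> z \<noteq> 0 \<longrightarrow> Re z < 0)"

end

theory Submission
  imports Defs
begin

text \<open>
  Uniqueness of the optimum makes row and column sums injective on matrices supported on the
  activities, and connectedness makes every pool have load exactly \<open>rho\<close> at the optimum.

  Local stability: since \<open>mu i j = m j\<close>, multiplication by \<open>m j\<close> preserves vanishing pool totals, so
  in occupancy coordinates the linearised dynamics is \<open>z i j' = - m j * z i j\<close>.

  Global stability: at almost every time the extremal queues or loads share one derivative, which
  the two rules of the fluid model determine, and the planning problem fixes its sign. Thus the
  largest queue decreases, strictly unless all queues are equal (or \<open>rho < 1\<close>), the smallest load
  is driven up to \<open>rho\<close>, and, once the queues are empty, the largest load is driven down to \<open>rho\<close>.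
  The occupancies then converge by the same diagonal dynamics, up to a vanishing error. As the
  rules hold at regular points only, this rests on the almost everywhere differentiability of
  Lipschitz functions, a consequence of the Vitali covering theorem.
\<close>

section \<open>Lipschitz functions are differentiable almost everywhere\<close>

text \<open>The rates depending on the pool only enters the global proof as one fact: a pool
  completes work at rate \<open>bet j * m j * load j\<close> whatever types it holds. Hence the
  drift of an extremal set of queues or pools does not depend on the unknown mix of types. The rules
  of the fluid model speak only of sets of largest queues and of sets of least loads. The largest
  load is therefore reached through the complement of its pools, which requires the queues to have
  vanished already; this is why the order of these results matters for \<open>rho < 1\<close>. For
  \<open>rho = 1\<close> the bound by 1 is part of the model. For \<open>rho = 1\<close> the
  decrease of the largest queue is not uniformly strict, since it stops when all queues agree. It is
  played against a second monotone quantity, the total of \<open>x\<close>: together with the loads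
  they show that the spread of the queues has a limit, and a positive limit is impossible. The last
  step is formulated in \<open>x\<close>, the component that is differentiable at every positive
  time.\<close>

lemma vitali_intervals:
  fixes f :: "real \<Rightarrow> real"
  assumes "open U" and "S \<subseteq> U"
    and fine: "\<And>x d. x \<in> S \<Longrightarrow> 0 < d \<Longrightarrow> \<exists>y. y \<noteq> x \<and> \<bar>y - x\<bar> < d \<and> R ((f y - f x) / (y - x))"
  obtains C where "countable C"
    and "\<And>a b. (a, b) \<in> C \<Longrightarrow> a < b \<and> R ((f b - f a) / (b - a))"
    and "disjoint_family_on (\<lambda>(a, b). {a<..<b}) C"
    and "(\<Union>(a, b)\<in>C. {a<..<b}) \<subseteq> U"
    and "negligible (S - (\<Union>(a, b)\<in>C. {a<..<b}))"
proof -
  \<comment> \<open>The interval between \<open>x\<close> and a nearby \<open>y\<close> has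
    \<open>x\<close> as an endpoint, never as its centre. That is enough: the covering theorem only
    asks the balls to contain the point.\<close>
  define K where "K = {(a, b). a < b \<and> {a..b} \<subseteq> U \<and> R ((f b - f a) / (b - a))}"
  define c where "c = (\<lambda>(a, b). (a + b) / 2 :: real)"
  define r where "r = (\<lambda>(a, b). (b - a) / 2 :: real)"
  have cb: "cball (c i) (r i) = {fst i..snd i}" for i
    by (cases i) (auto simp: c_def r_def cball_eq_atLeastAtMost field_simps)
  have r: "0 < r i" if "i \<in> K" for i
    using that by (auto simp: K_def r_def)
  have S: "\<exists>i. i \<in> K \<and> x \<in> cball (c i) (r i) \<and> r i < d" if x: "x \<in> S" and d: "0 < d" for x d
  proof -
    from x assms obtain e where e: "0 < e" "cball x e \<subseteq> U"
      by (meson open_contains_cball subsetD)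
    obtain y where y: "y \<noteq> x" "\<bar>y - x\<bar> < min d e" "R ((f y - f x) / (y - x))"
      using fine[OF x, of "min d e"] d e by auto
    have sub: "{min x y..max x y} \<subseteq> U"
      using y e by (auto simp: cball_eq_atLeastAtMost abs_if split: if_splits intro!: subsetD[OF e(2)])
    have sw: "(f x - f y) / (x - y) = (f y - f x) / (y - x)"
      by (metis minus_diff_eq minus_divide_divide)
    have "(min x y, max x y) \<in> K"
      using y sub sw by (auto simp: K_def min_def max_def)
    moreover have "x \<in> cball (c (min x y, max x y)) (r (min x y, max x y))"
      unfolding cb by auto
    moreover have "r (min x y, max x y) < d"
      using y by (auto simp: r_def)
    ultimately show ?thesis by blast
  qed
  obtain C where C: "countable C" "C \<subseteq> K"
    "pairwise (\<lambda>i j. disjnt (cball (c i) (r i)) (cball (c j) (r j))) C"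
    "negligible (S - (\<Union>i\<in>C. cball (c i) (r i)))"
    by (rule Vitali_covering_theorem_cballs[OF r S])
  have "disjoint_family_on (\<lambda>(a, b). {a<..<b}) C"
  proof (unfold disjoint_family_on_def, intro ballI impI)
    fix m n assume "m \<in> C" "n \<in> C" "m \<noteq> n"
    then have "disjnt {fst m..snd m} {fst n..snd n}"
      using C(3) unfolding pairwise_def cb by blast
    then show "(case m of (a, b) \<Rightarrow> {a<..<b}) \<inter> (case n of (a, b) \<Rightarrow> {a<..<b}) = {}"
      by (fastforce simp: disjnt_def disjoint_iff split: prod.splits)
  qed
  moreover have "(\<Union>(a, b)\<in>C. {a<..<b}) \<subseteq> U"
    using C(2) by (fastforce simp: K_def)
  moreover have "negligible (S - (\<Union>(a, b)\<in>C. {a<..<b}))"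
  proof (rule negligible_subset)
    \<comment> \<open>Passing from closed to open intervals loses only countably many endpoints, and
      the open union can then serve as the \<open>U\<close> of a further covering.\<close>
    have "countable ((\<Union>i\<in>C. {fst i, snd i}))"
      using C(1) by auto
    then have "negligible (\<Union>i\<in>C. {fst i, snd i})"
      using countable_imp_null_set_lborel negligible_iff_null_sets null_sets_completionI by blast
    then show "negligible ((S - (\<Union>i\<in>C. cball (c i) (r i))) \<union> (\<Union>i\<in>C. {fst i, snd i}))"
      using C(4) by (intro negligible_Un)
    show "S - (\<Union>(a, b)\<in>C. {a<..<b}) \<subseteq> (S - (\<Union>i\<in>C. cball (c i) (r i))) \<union> (\<Union>i\<in>C. {fst i, snd i})"
      unfolding cb by (force split: prod.splits)
  qed
  moreover have "a < b \<and> R ((f b - f a) / (b - a))" if "(a, b) \<in> C" for a b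
    using that C(2) by (auto simp: K_def)
  ultimately show thesis
    using that C(1) by blast
qed

section \<open>Dini derivatives of continuous monotone functions\<close>

context
  fixes f :: "real \<Rightarrow> real"
  assumes mono: "mono f" and cont: "continuous_on UNIV f"
begin

text \<open>Continuity of \<open>f\<close> makes single points null for its Stieltjes measure, so
  endpoints do not matter.\<close>

private lemma emeasure_Ioo: "a < b \<Longrightarrow> emeasure (interval_measure f) {a<..<b} = ennreal (f b - f a)"
proof -
  assume ab: "a < b"
  have Icc: "emeasure (interval_measure f) {s..t} = f t - f s" if "s \<le> t" for s t
    using that mono cont by (intro emeasure_interval_measure_Icc) (auto dest: monoD)
  have "{a, b} \<in> null_sets (interval_measure f)"
  proof -
    have "{a} \<in> null_sets (interval_measure f)" "{b} \<in> null_sets (interval_measure f)"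
      using Icc[of a a] Icc[of b b] by auto
    then show ?thesis
      using null_sets.Un[of "{a}" "interval_measure f" "{b}"] by (simp add: insert_commute)
  qed
  moreover have "{a<..<b} = {a..b} - {a, b}"
    by auto
  ultimately show ?thesis
    using Icc[of a b] ab by (simp add: emeasure_Diff_null_set)
qed

private lemma emeasure_UN_Ioo:
  assumes "countable C" "disjoint_family_on (\<lambda>(a, b). {a<..<b}) C" "sets M = sets borel"
  shows "emeasure M (\<Union>(a, b)\<in>C. {a<..<b::real}) = (\<integral>\<^sup>+i. emeasure M {fst i<..<snd i} \<partial>count_space C)"
  using assms by (subst emeasure_UN_countable) (auto simp: split_beta)

text \<open>The increase of \<open>f\<close> over disjoint intervals is their Stieltjes measure.
  Intervals of slope below \<open>p\<close> cover \<open>E\<close> up to a null set and give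
  \<open>V\<close> inside \<open>U\<close>; inside \<open>V\<close>, intervals of slope above
  \<open>q\<close> cover \<open>E\<close> again and give \<open>W\<close>. So \<open>q\<close> times
  the length of \<open>W\<close> is at most the Stieltjes measure of \<open>W\<close>, hence that of
  \<open>V\<close>, hence \<open>p\<close> times the length of \<open>U\<close>.\<close>

private lemma dini_step:
  assumes E: "\<And>x d. x \<in> E \<Longrightarrow> 0 < d \<Longrightarrow>
      (\<exists>y. y \<noteq> x \<and> \<bar>y - x\<bar> < d \<and> (f y - f x) / (y - x) < p) \<and>
      (\<exists>y. y \<noteq> x \<and> \<bar>y - x\<bar> < d \<and> (f y - f x) / (y - x) > q)"
    and p: "0 \<le> p" and q: "0 \<le> q" and U: "open U" "E \<subseteq> U"
  shows "\<exists>W. open W \<and> W \<subseteq> U \<and> negligible (E - W) \<and>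
    ennreal q * emeasure lborel W \<le> ennreal p * emeasure lborel U"
proof -
  let ?N = "interval_measure f"
  obtain C where C: "countable C" "\<And>a b. (a, b) \<in> C \<Longrightarrow> a < b \<and> (f b - f a) / (b - a) < p"
    "disjoint_family_on (\<lambda>(a, b). {a<..<b}) C" "(\<Union>(a, b)\<in>C. {a<..<b}) \<subseteq> U"
    "negligible (E - (\<Union>(a, b)\<in>C. {a<..<b}))"
    by (rule vitali_intervals[OF U, of "\<lambda>s. s < p" f]) (use E in blast)+
  define V where "V = (\<Union>(a, b)\<in>C. {a<..<b})"
  have V: "open V"
    unfolding V_def by (intro open_UN) auto
  obtain D where D: "countable D" "\<And>a b. (a, b) \<in> D \<Longrightarrow> a < b \<and> (f b - f a) / (b - a) > q"
    "disjoint_family_on (\<lambda>(a, b). {a<..<b}) D" "(\<Union>(a, b)\<in>D. {a<..<b}) \<subseteq> V"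
    "negligible ((E \<inter> V) - (\<Union>(a, b)\<in>D. {a<..<b}))"
    by (rule vitali_intervals[OF V, of "E \<inter> V" "\<lambda>s. s > q" f]) (use E in blast)+
  define W where "W = (\<Union>(a, b)\<in>D. {a<..<b})"
  have W: "open W"
    unfolding W_def by (intro open_UN) auto
  have "ennreal q * emeasure lborel W = (\<integral>\<^sup>+i. ennreal q * emeasure lborel {fst i<..<snd i} \<partial>count_space D)"
    unfolding W_def using D by (subst emeasure_UN_Ioo) (auto simp: nn_integral_cmult)
  also have "\<dots> \<le> (\<integral>\<^sup>+i. emeasure ?N {fst i<..<snd i} \<partial>count_space D)"
  proof (rule nn_integral_mono)
    fix i assume "i \<in> space (count_space D)"
    then have i: "fst i < snd i" "(f (snd i) - f (fst i)) / (snd i - fst i) > q"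
      using D(2)[of "fst i" "snd i"] by auto
    then have "q * (snd i - fst i) \<le> f (snd i) - f (fst i)"
      by (simp add: field_simps)
    then show "ennreal q * emeasure lborel {fst i<..<snd i} \<le> emeasure ?N {fst i<..<snd i}"
      using i q by (simp add: emeasure_Ioo ennreal_mult[symmetric] ennreal_leI)
  qed
  also have "\<dots> = emeasure ?N W"
    unfolding W_def using D by (subst emeasure_UN_Ioo) auto
  also have "\<dots> \<le> emeasure ?N V"
    using D(4) V W by (intro emeasure_mono) (auto simp: W_def)
  also have "\<dots> = (\<integral>\<^sup>+i. emeasure ?N {fst i<..<snd i} \<partial>count_space C)"
    unfolding V_def using C by (subst emeasure_UN_Ioo) auto
  also have "\<dots> \<le> (\<integral>\<^sup>+i. ennreal p * emeasure lborel {fst i<..<snd i} \<partial>count_space C)"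
  proof (rule nn_integral_mono)
    fix i assume "i \<in> space (count_space C)"
    then have i: "fst i < snd i" "(f (snd i) - f (fst i)) / (snd i - fst i) < p"
      using C(2)[of "fst i" "snd i"] by auto
    then have "f (snd i) - f (fst i) \<le> p * (snd i - fst i)"
      by (simp add: field_simps)
    then show "emeasure ?N {fst i<..<snd i} \<le> ennreal p * emeasure lborel {fst i<..<snd i}"
      using i p by (simp add: emeasure_Ioo ennreal_mult[symmetric] ennreal_leI)
  qed
  also have "\<dots> = ennreal p * emeasure lborel V"
    unfolding V_def using C by (subst emeasure_UN_Ioo) (auto simp: nn_integral_cmult)
  also have "\<dots> \<le> ennreal p * emeasure lborel U"
    using C(4) U by (intro mult_left_mono emeasure_mono) (auto simp: V_def)
  finally have "ennreal q * emeasure lborel W \<le> ennreal p * emeasure lborel U" .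
  moreover have "negligible (E - W)"
    by (rule negligible_subset[OF negligible_Un[OF C(5) D(5)]]) (auto simp: V_def W_def)
  moreover have "W \<subseteq> U"
    using C(4) D(4) by (auto simp: V_def W_def)
  ultimately show ?thesis
    using W by blast
qed

text \<open>Each use of \<open>dini_step\<close> shrinks an open set that covers \<open>E\<close> up
  to a null set by the factor \<open>p / q < 1\<close>. Starting from a bounded interval, the outer
  measure of \<open>E\<close> falls below every positive bound.\<close>

private lemma dini_gap_bounded:
  assumes E: "\<And>x d. x \<in> E \<Longrightarrow> 0 < d \<Longrightarrow>
      (\<exists>y. y \<noteq> x \<and> \<bar>y - x\<bar> < d \<and> (f y - f x) / (y - x) < p) \<and>
      (\<exists>y. y \<noteq> x \<and> \<bar>y - x\<bar> < d \<and> (f y - f x) / (y - x) > q)"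
    and pq: "0 \<le> p" "p < q" and bdd: "E \<subseteq> {-n<..<n}"
  shows "negligible E"
proof (cases "0 \<le> n")
  case False
  with bdd have "E = {}" by auto
  then show ?thesis by simp
next
  case n: True
  have step: "\<exists>W. open W \<and> W \<subseteq> {-n<..<n} \<and> negligible (E - W) \<and>
      measure lebesgue W \<le> (p / q) ^ k * (2 * n)" for k
  proof (induction k)
    case 0
    show ?case
      using bdd n by (intro exI[of _ "{-n<..<n}"]) (auto simp: Diff_eq_empty_iff[THEN iffD2])
  next
    case (Suc k)
    then obtain U where U: "open U" "U \<subseteq> {-n<..<n}" "negligible (E - U)"
        "measure lebesgue U \<le> (p / q) ^ k * (2 * n)" by blast
    have "\<exists>W. open W \<and> W \<subseteq> U \<and> negligible (E \<inter> U - W) \<and>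
      ennreal q * emeasure lborel W \<le> ennreal p * emeasure lborel U"
      by (rule dini_step) (use E pq U in auto)
    then obtain W where W: "open W" "W \<subseteq> U" "negligible (E \<inter> U - W)"
      "ennreal q * emeasure lborel W \<le> ennreal p * emeasure lborel U" by blast
    have fm: "A \<in> fmeasurable lborel" if A: "A \<subseteq> {-n<..<n}" "open A" for A
    proof (rule fmeasurableI2)
      show "{-n<..<n} \<in> fmeasurable lborel"
        using n by (intro fmeasurableI) auto
    qed (use A in auto)
    have em: "emeasure lborel A = ennreal (measure lebesgue A)" if "A \<subseteq> {-n<..<n}" "open A" for A
      using emeasure_eq_measure2[OF fm[OF that]] measure_completion[of A lborel] that(2) by simp
    have "q * measure lebesgue W \<le> p * measure lebesgue U"
      using W(4) em[of W] em[of U] W U pq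
      by (simp add: ennreal_mult[symmetric] ennreal_le_iff)
    then have "measure lebesgue W \<le> (p / q) * measure lebesgue U"
      using pq by (simp add: field_simps)
    also have "\<dots> \<le> (p / q) * ((p / q) ^ k * (2 * n))"
      using U(4) pq by (intro mult_left_mono) auto
    finally have "measure lebesgue W \<le> (p / q) ^ Suc k * (2 * n)" by simp
    moreover have "negligible (E - W)"
      by (rule negligible_subset[OF negligible_Un[OF U(3) W(3)]]) auto
    ultimately show ?case
      using W U by (intro exI[of _ W]) auto
  qed
  show ?thesis
    unfolding negligible_outer_le
  proof (intro allI impI)
    fix e :: real assume e: "0 < e"
    have "(\<lambda>k. (p / q) ^ k * (2 * n)) \<longlonglongrightarrow> 0 * (2 * n)"
      using pq by (intro tendsto_intros LIMSEQ_realpow_zero) (auto simp: field_simps)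
    then have "\<forall>\<^sub>F k in sequentially. (p / q) ^ k * (2 * n) < e"
      using e by (intro order_tendstoD) auto
    then obtain k where k: "(p / q) ^ k * (2 * n) < e"
      by (meson eventually_at_top_linorder order_refl)
    obtain W where W: "open W" "W \<subseteq> {-n<..<n}" "negligible (E - W)"
      "measure lebesgue W \<le> (p / q) ^ k * (2 * n)"
      using step by blast
    have Wm: "W \<in> lmeasurable"
      using W by (intro lmeasurable_open bounded_subset[OF bounded_box(1)[of "-n" n]]) (auto simp: box_real)
    have "measure lebesgue (W \<union> (E - W)) \<le> measure lebesgue W + measure lebesgue (E - W)"
      using Wm W(3) by (intro measure_Un_le) (auto dest: negligible_imp_sets)
    also have "\<dots> \<le> e"
      using W k negligible_imp_measure0[OF W(3)] by simp
    finally show "\<exists>T. E \<subseteq> T \<and> T \<in> lmeasurable \<and> measure lebesgue T \<le> e"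
      using fmeasurable.Un[OF Wm negligible_imp_measurable[OF W(3)]]
      by (intro exI[of _ "W \<union> (E - W)"]) auto
  qed
qed

text \<open>Failure of differentiability with bounded slopes means oscillation across some gap with
  rational ends, so countably many of these sets suffice.\<close>

private definition dini_gap :: "real \<Rightarrow> real \<Rightarrow> real set" where
  "dini_gap p q = {x. \<forall>d>0. (\<exists>y. y \<noteq> x \<and> \<bar>y - x\<bar> < d \<and> (f y - f x) / (y - x) < p) \<and>
      (\<exists>y. y \<noteq> x \<and> \<bar>y - x\<bar> < d \<and> (f y - f x) / (y - x) > q)}"

private lemma negligible_dini_gap:
  assumes "0 \<le> p" "p < q"
  shows "negligible (dini_gap p q)"
proof -
  have "negligible (dini_gap p q \<inter> {-real n<..<real n})" for n
    by (rule dini_gap_bounded[OF _ assms]) (auto simp: dini_gap_def)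
  then have "negligible (\<Union>n. dini_gap p q \<inter> {-real n<..<real n})"
    by (intro negligible_countable_Union) auto
  moreover have "dini_gap p q \<subseteq> (\<Union>n. dini_gap p q \<inter> {-real n<..<real n})"
  proof
    fix x assume x: "x \<in> dini_gap p q"
    obtain n where "\<bar>x\<bar> < real n"
      using reals_Archimedean2 by blast
    then show "x \<in> (\<Union>n. dini_gap p q \<inter> {-real n<..<real n})"
      using x by (auto simp: abs_less_iff intro!: exI[of _ n])
  qed
  ultimately show ?thesis
    by (rule negligible_subset)
qed

private lemma slope_nonneg: "0 \<le> (f y - f x) / (y - x)"
proof (cases "x \<le> y")
  case True
  then show ?thesis using monoD[OF mono, of x y] by simp
next
  case False
  then show ?thesis using monoD[OF mono, of y x] by (simp add: divide_nonpos_nonpos)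
qed

private lemma differentiable_outside_dini_gap:
  assumes x: "\<And>p q. p \<in> \<rat> \<Longrightarrow> q \<in> \<rat> \<Longrightarrow> 0 \<le> p \<Longrightarrow> p < q \<Longrightarrow> x \<notin> dini_gap p q"
    and B: "\<And>y. (f y - f x) / (y - x) \<le> B"
  shows "f differentiable at x"
proof -
  let ?s = "\<lambda>y. (f y - f x) / (y - x)"
  \<comment> \<open>The eventual upper bounds of the slopes: \<open>Inf A\<close> is their limsup at
    \<open>x\<close>.\<close>
  define A where "A = {c. \<forall>\<^sub>F y in at x. ?s y \<le> c}"
  have A0: "0 \<le> c" if "c \<in> A" for c
  proof (rule ccontr)
    assume "\<not> 0 \<le> c"
    then have no: "\<not> ?s y \<le> c" for y
      using slope_nonneg[of y x] by linarith
    have "\<forall>\<^sub>F y in at x. False"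
      using that unfolding A_def mem_Collect_eq by (rule eventually_mono) (use no in blast)
    then show False by simp
  qed
  have A: "A \<noteq> {}" "bdd_below A"
    using B A0 by (auto simp: A_def intro!: exI[of _ B] bdd_belowI)
  define D where "D = Inf A"
  have "(?s \<longlongrightarrow> D) (at x)"
  proof (rule order_tendstoI)
    fix u assume "D < u"
    then obtain c where "c \<in> A" "c < u"
      using cInf_less_iff[OF A] by (auto simp: D_def)
    then show "\<forall>\<^sub>F y in at x. ?s y < u"
      by (auto simp: A_def elim!: eventually_mono)
  next
    fix u assume "u < D"
    show "\<forall>\<^sub>F y in at x. u < ?s y"
    proof (rule ccontr)
      assume not: "\<not> (\<forall>\<^sub>F y in at x. u < ?s y)"
      \<comment> \<open>If slopes not above \<open>u\<close> recur near \<open>x\<close>, then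
        slopes below \<open>p\<close> and slopes above \<open>q\<close> both recur there. Rational
        \<open>p\<close> and \<open>q\<close> keep the exceptional family countable.\<close>
      obtain p where p: "p \<in> \<rat>" "u < p" "p < D"
        using Rats_dense_in_real[OF \<open>u < D\<close>] by auto
      obtain q where q: "q \<in> \<rat>" "p < q" "q < D"
        using Rats_dense_in_real[OF p(3)] by auto
      have "q \<notin> A"
        using q(3) cInf_lower[OF _ A(2)] by (force simp: D_def)
      then have hi: "\<not> (\<forall>\<^sub>F y in at x. ?s y \<le> q)"
        by (simp add: A_def)
      have "x \<in> dini_gap p q"
        unfolding dini_gap_def
      proof (intro CollectI allI impI conjI)
        fix d :: real assume "0 < d"
        show "\<exists>y. y \<noteq> x \<and> \<bar>y - x\<bar> < d \<and> ?s y < p"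
        proof (rule ccontr)
          assume "\<nexists>y. y \<noteq> x \<and> \<bar>y - x\<bar> < d \<and> ?s y < p"
          then have "\<forall>\<^sub>F y in at x. u < ?s y"
            using p(2) \<open>0 < d\<close> unfolding eventually_at dist_real_def
            by (intro exI[of _ d]) (meson less_le_trans not_less)
          with not show False by simp
        qed
        show "\<exists>y. y \<noteq> x \<and> \<bar>y - x\<bar> < d \<and> ?s y > q"
        proof (rule ccontr)
          assume "\<nexists>y. y \<noteq> x \<and> \<bar>y - x\<bar> < d \<and> ?s y > q"
          then have "\<forall>\<^sub>F y in at x. ?s y \<le> q"
            using \<open>0 < d\<close> unfolding eventually_at dist_real_def
            by (intro exI[of _ d]) (meson not_less)
          with hi show False by simp
        qed
      qed
      moreover have "0 \<le> p"
      proof (rule ccontr)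
        assume "\<not> 0 \<le> p"
        then have "u < 0" using p by linarith
        then have "u < ?s y" for y using slope_nonneg[of y x] by linarith
        with not show False by simp
      qed
      ultimately show False
        using x p q by blast
    qed
  qed
  then have "(f has_real_derivative D) (at x)"
    by (simp add: has_field_derivative_iff)
  then show ?thesis
    by (auto simp: real_differentiable_def)
qed

lemma negligible_nondifferentiable_mono:
  assumes "\<And>x y. (f y - f x) / (y - x) \<le> B"
  shows "negligible {x. \<not> f differentiable at x}"
proof (rule negligible_subset)
  let ?I = "{(p, q). p \<in> \<rat> \<and> q \<in> \<rat> \<and> 0 \<le> p \<and> p < q}"
  have "countable ?I"
    by (rule countable_subset[of _ "\<rat> \<times> \<rat>"]) (auto intro: countable_rat)
  then show "negligible (\<Union>(p, q)\<in>?I. dini_gap p q)"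
    by (intro negligible_countable_Union) (auto intro: negligible_dini_gap)
  show "{x. \<not> f differentiable at x} \<subseteq> (\<Union>(p, q)\<in>?I. dini_gap p q)"
  proof
    fix x assume "x \<in> {x. \<not> f differentiable at x}"
    then have "\<not> (\<forall>p q. p \<in> \<rat> \<longrightarrow> q \<in> \<rat> \<longrightarrow> 0 \<le> p \<longrightarrow> p < q \<longrightarrow> x \<notin> dini_gap p q)"
      using differentiable_outside_dini_gap[OF _ assms, of x] by fast
    then show "x \<in> (\<Union>(p, q)\<in>?I. dini_gap p q)"
      by auto
  qed
qed

end

section \<open>From monotone to Lipschitz functions\<close>

lemma lipschitz_onD_real: "L-lipschitz_on A f \<Longrightarrow> x \<in> A \<Longrightarrow> y \<in> A \<Longrightarrow> \<bar>f x - f y\<bar> \<le> L * \<bar>x - y\<bar>"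
  for f :: "real \<Rightarrow> real"
  using lipschitz_onD[of L A f x y] by (simp add: dist_real_def)

theorem negligible_nondifferentiable_lipschitz:
  fixes f :: "real \<Rightarrow> real"
  assumes lip: "L-lipschitz_on {a..} f"
  shows "negligible {t. a < t \<and> \<not> f differentiable at t}"
proof (rule negligible_subset)
  \<comment> \<open>The linear term makes \<open>g\<close> monotone, since \<open>f\<close> cannot
    fall faster than with slope \<open>-L\<close>. The constant extension to the left of
    \<open>a\<close> does not affect derivatives at \<open>t > a\<close>.\<close>
  define g where "g t = f (max a t) + L * t" for t
  have L: "0 \<le> L" using lipschitz_on_nonneg[OF lip] .
  have lip': "\<bar>f (max a x) - f (max a y)\<bar> \<le> L * \<bar>x - y\<bar>" for x y
  proof -
    have "\<bar>f (max a x) - f (max a y)\<bar> \<le> L * \<bar>max a x - max a y\<bar>"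
      by (rule lipschitz_onD_real[OF lip]) auto
    also have "\<dots> \<le> L * \<bar>x - y\<bar>"
      by (intro mult_left_mono L) auto
    finally show ?thesis .
  qed
  have mono: "mono g"
  proof (rule monoI)
    fix x y :: real assume "x \<le> y"
    with lip'[of x y] show "g x \<le> g y"
      by (auto simp: g_def algebra_simps abs_if split: if_splits)
  qed
  have lg: "(2 * L)-lipschitz_on UNIV g"
  proof (rule lipschitz_onI)
    fix x y
    show "dist (g x) (g y) \<le> 2 * L * dist x y"
    proof -
      have "g x - g y = (f (max a x) - f (max a y)) + L * (x - y)"
        by (simp add: g_def algebra_simps)
      then have "\<bar>g x - g y\<bar> \<le> \<bar>f (max a x) - f (max a y)\<bar> + \<bar>L * (x - y)\<bar>"
        by (simp only: abs_triangle_ineq)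
      also have "\<bar>L * (x - y)\<bar> = L * \<bar>x - y\<bar>"
        using L by (simp only: abs_mult abs_of_nonneg)
      finally show ?thesis
        using lip'[of x y] unfolding dist_real_def by linarith
    qed
  qed (use L in auto)
  have "(g y - g x) / (y - x) \<le> 2 * L" for x y
  proof (cases "x = y")
    case False
    have "\<bar>(g y - g x) / (y - x)\<bar> \<le> 2 * L"
      using lipschitz_onD_real[OF lg, of y x] False by (simp add: abs_divide divide_simps)
    then show ?thesis by linarith
  qed (use L in simp)
  then show "negligible {t. \<not> g differentiable at t}"
    using negligible_nondifferentiable_mono[OF mono lipschitz_on_continuous_on[OF lg]] by blast
  show "{t. a < t \<and> \<not> f differentiable at t} \<subseteq> {t. \<not> g differentiable at t}"
  proof (intro subsetI CollectI notI, elim CollectE conjE)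
    fix t assume t: "a < t" "g differentiable at t" "\<not> f differentiable at t"
    then have "(\<lambda>t. g t - L * t) differentiable at t"
      by (intro differentiable_diff differentiable_mult) auto
    then obtain F where "((\<lambda>t. g t - L * t) has_derivative F) (at t)"
      by (auto simp: differentiable_def)
    then have "(f has_derivative F) (at t)"
      by (rule has_derivative_transform_within_open[of _ _ _ _ "{a<..}"]) (use t in \<open>auto simp: g_def max_def\<close>)
    with t show False by (auto simp: differentiable_def)
  qed
qed

section \<open>Monotonicity and decay from almost everywhere derivatives\<close>

text \<open>\<open>c\<close> is the last time at which \<open>G\<close> is at most \<open>y\<close>;
  it exists by compactness. Both uses obtain a contradiction because the function cannot stay higher
  after \<open>c\<close>.\<close>

lemma continuous_increase_point:
  fixes G :: "real \<Rightarrow> real"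
  assumes "a \<le> b" and cont: "continuous_on {a..b} G" and y: "G a \<le> y" "y < G b"
  obtains c where "a \<le> c" "c < b" "G c \<le> y" "\<And>t. c < t \<Longrightarrow> t \<le> b \<Longrightarrow> y < G t"
proof -
  let ?A = "{a..b} \<inter> G -` {..y}"
  have "closed ?A"
    using cont by (rule continuous_closed_preimage) auto
  then have "compact ({a..b} \<inter> ?A)"
    by (rule compact_Int_closed[OF compact_Icc])
  then have "compact ?A" by simp
  moreover have "?A \<noteq> {}"
    using assms by auto
  ultimately obtain c where c: "c \<in> ?A" "\<And>t. t \<in> ?A \<Longrightarrow> t \<le> c"
    using compact_attains_sup[of ?A] by metis
  show thesis
  proof (rule that)
    show "a \<le> c" "G c \<le> y" using c by auto
    show "c < b" using c y by (cases "c = b") auto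
    show "y < G t" if "c < t" "t \<le> b" for t
      using c(2)[of t] that \<open>a \<le> c\<close> by (force simp: not_le[symmetric])
  qed
qed

text \<open>A Lipschitz function gains nothing on a null set. Cover the exceptional set by an open
  \<open>U\<close> of measure at most \<open>e\<close>, charge growth inside \<open>U\<close> to
  \<open>L\<close> times the measure of \<open>U\<close> swept so far and growth elsewhere to a
  slope \<open>e\<close>, and let \<open>e\<close> tend to 0.\<close>

lemma antimono_of_ae_derivative_nonpos:
  fixes f :: "real \<Rightarrow> real"
  assumes ab: "a \<le> b" and lip: "L-lipschitz_on {a..b} f" and N: "negligible N"
    and deriv: "\<And>t. a < t \<Longrightarrow> t < b \<Longrightarrow> t \<notin> N \<Longrightarrow> \<exists>D\<le>0. (f has_real_derivative D) (at t)"
  shows "f b \<le> f a"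
proof -
  have L: "0 \<le> L" using lipschitz_on_nonneg[OF lip] .
  have main: "f b \<le> f a + e * (b - a + L)" if e: "0 < e" for e
  proof -
    \<comment> \<open>The derivative is known only at interior times. With \<open>a\<close> in the
      exceptional set, the fact \<open>right\<close> also covers \<open>c = a\<close>.\<close>
    let ?N = "insert a N"
    have N': "negligible ?N" using N by simp
    then have "?N \<in> sets lebesgue" by (rule negligible_imp_sets)
    then obtain U where U: "open U" "?N \<subseteq> U" "U - ?N \<in> lmeasurable" "emeasure lebesgue (U - ?N) < ennreal e"
      using sets_lebesgue_outer_open[OF _ e] by metis
    have Um: "U \<in> lmeasurable"
    proof -
      have "U = (U - ?N) \<union> ?N" using U(2) by blast
      then show ?thesis
        using fmeasurable.Un[OF U(3) negligible_imp_measurable[OF N']] by simp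
    qed
    have mU: "measure lebesgue U \<le> e"
    proof -
      have "measure lebesgue U \<le> measure lebesgue (U - ?N) + measure lebesgue ?N"
        using measure_Un_le[of "U - ?N" lebesgue ?N] fmeasurableD[OF U(3)] negligible_imp_sets[OF N']
          Un_Diff_cancel2[of U ?N] U(2) by (metis sup.absorb1)
      also have "measure lebesgue (U - ?N) \<le> e"
        using U(4) e by (simp add: emeasure_eq_measure2[OF U(3)] ennreal_less_iff)
      finally show ?thesis
        using negligible_imp_measure0[OF N'] by simp
    qed
    define m where "m t = measure lebesgue (U \<inter> {a..t})" for t
    have Um_Int: "U \<inter> {s..t} \<in> lmeasurable" "U \<inter> {s<..t} \<in> lmeasurable" for s t
      using Um U(1) by (auto intro!: fmeasurableI2[OF Um])
    have m_diff: "m t = m s + measure lebesgue (U \<inter> {s<..t})" if "a \<le> s" "s \<le> t" for s t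
    proof -
      have *: "U \<inter> {a..t} = (U \<inter> {a..s}) \<union> (U \<inter> {s<..t})"
        using that by auto
      show ?thesis
        unfolding m_def * by (subst measure_Un2[OF Um_Int])
          (auto intro!: arg_cong[where f = "measure lebesgue"])
    qed
    \<comment> \<open>Inside \<open>U\<close> the term \<open>L * m t\<close> grows at rate
      \<open>L\<close> and compensates \<open>f\<close>; outside \<open>U\<close> the derivative of
      \<open>f\<close> is below \<open>e\<close>. So every point is followed by a later one at which
      \<open>G\<close> is no larger.\<close>
    define G where "G t = f t - e * (t - a) - L * m t" for t
    have m_le: "measure lebesgue (U \<inter> {s<..t}) \<le> t - s" if "s \<le> t" for s t
    proof -
      have "measure lebesgue (U \<inter> {s<..t}) \<le> measure lebesgue {s..t}"
        using Um_Int by (intro measure_mono_fmeasurable) auto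
      with that show ?thesis by simp
    qed
    have "1-lipschitz_on {a..b} m"
    proof (rule lipschitz_on_leI)
      fix s t assume "s \<in> {a..b}" "t \<in> {a..b}" "s \<le> t"
      then have "m t - m s = measure lebesgue (U \<inter> {s<..t})" "0 \<le> t - s"
          "measure lebesgue (U \<inter> {s<..t}) \<le> t - s"
        using m_diff[of s t] m_le[of s t] by auto
      then show "dist (m s) (m t) \<le> 1 * dist s t"
        using measure_nonneg[of lebesgue "U \<inter> {s<..t}"]
        by (simp add: dist_real_def abs_minus_commute[of "m s"] abs_minus_commute[of s])
    qed simp
    then have "continuous_on {a..b} m"
      by (rule lipschitz_on_continuous_on)
    then have cont: "continuous_on {a..b} G"
      unfolding G_def using lipschitz_on_continuous_on[OF lip] by (intro continuous_intros)
    have right: "\<exists>s. c < s \<and> s \<le> b \<and> G s \<le> G c" if c: "a \<le> c" "c < b" for c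
    proof (cases "c \<in> U")
      case True
      with U(1) obtain d where d: "0 < d" "ball c d \<subseteq> U"
        using open_contains_ball by blast
      define s where "s = min b (c + d / 2)"
      have s: "c < s" "s \<le> b" "s < c + d"
        using d c by (auto simp: s_def min_def)
      have "{c<..s} \<subseteq> U"
        using d(2) s by (auto simp: ball_eq_greaterThanLessThan)
      then have "U \<inter> {c<..s} = {c<..s}" by auto
      then have "L * m s = L * m c + L * (s - c)"
        using m_diff[of c s] c s by (simp add: distrib_left)
      moreover have "f s - f c \<le> L * (s - c)"
        using lipschitz_onD_real[OF lip, of s c] s c by auto
      moreover have "e * (c - a) \<le> e * (s - a)"
        using e s by (intro mult_left_mono) auto
      ultimately have "G s \<le> G c"
        by (simp add: G_def algebra_simps)
      with s show ?thesis by blast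
    next
      case False
      with U(2) c have "a < c" "c \<notin> N"
        by (auto simp: less_le)
      then obtain D where D: "D \<le> 0" "(f has_real_derivative D) (at c)"
        using deriv c by blast
      then have "((\<lambda>t. (f t - f c) / (t - c)) \<longlongrightarrow> D) (at c)"
        by (simp add: has_field_derivative_iff)
      then have "\<forall>\<^sub>F t in at c. (f t - f c) / (t - c) < e"
        by (rule order_tendstoD(2)) (use D e in auto)
      then obtain d where d: "0 < d" "\<And>t. t \<noteq> c \<Longrightarrow> \<bar>t - c\<bar> < d \<Longrightarrow> (f t - f c) / (t - c) < e"
        by (auto simp: eventually_at dist_real_def)
      define s where "s = min b (c + d / 2)"
      have s: "c < s" "s \<le> b" "s < c + d"
        using d c by (auto simp: s_def min_def)
      have "f s - f c < e * (s - c)"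
        using d(2)[of s] s by (simp add: field_simps)
      moreover have "L * m c \<le> L * m s"
        using m_diff[of c s] s c L by (intro mult_left_mono) auto
      ultimately have "G s \<le> G c"
        by (simp add: G_def algebra_simps)
      with s show ?thesis by blast
    qed
    have "G b \<le> G a"
    proof (rule ccontr)
      assume "\<not> G b \<le> G a"
      then obtain c where c: "a \<le> c" "c < b" "G c \<le> G a" "\<And>t. c < t \<Longrightarrow> t \<le> b \<Longrightarrow> G a < G t"
        using continuous_increase_point[OF ab cont order_refl] by (metis not_le)
      then show False
        using right[of c] by force
    qed
    moreover have "m b \<le> e"
    proof -
      have "m b \<le> measure lebesgue U"
        unfolding m_def using Um Um_Int by (intro measure_mono_fmeasurable) auto
      with mU show ?thesis by linarith
    qed
    then have "L * m b \<le> L * e"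
      using L by (rule mult_left_mono)
    moreover have "m a = 0"
      unfolding m_def by (intro negligible_imp_measure0 negligible_subset[OF negligible_sing[of a]]) auto
    ultimately show ?thesis
      by (simp add: G_def algebra_simps)
  qed
  show ?thesis
  proof (rule ccontr)
    assume "\<not> f b \<le> f a"
    then have gap: "0 < f b - f a" by simp
    \<comment> \<open>The choice of \<open>e\<close> below makes the error at most half of the
      supposed increase; the summand 1 keeps \<open>p\<close> positive.\<close>
    define p where "p = b - a + L + 1"
    have p: "0 < p" "b - a + L \<le> p" using ab L by (auto simp: p_def)
    define e where "e = (f b - f a) / (2 * p)"
    have "0 < e" using gap p by (simp add: e_def)
    have "f b - f a \<le> e * (b - a + L)"
      using main[OF \<open>0 < e\<close>] by (simp only: diff_le_eq add.commute)
    also have "\<dots> \<le> e * p"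
      using \<open>0 < e\<close> p by (intro mult_left_mono) auto
    also have "\<dots> = (f b - f a) / 2"
      using p by (simp add: e_def)
    finally show False
      using gap by simp
  qed
qed

lemma ae_derivative_le_imp_diff_le:
  fixes f :: "real \<Rightarrow> real"
  assumes ab: "a \<le> b" and lip: "L-lipschitz_on {a..b} f" and N: "negligible N"
    and deriv: "\<And>t. a < t \<Longrightarrow> t < b \<Longrightarrow> t \<notin> N \<Longrightarrow> \<exists>D\<le>c. (f has_real_derivative D) (at t)"
  shows "f b - f a \<le> c * (b - a)"
proof -
  have "(\<lambda>t. f t - c * t) b \<le> (\<lambda>t. f t - c * t) a"
  proof (rule antimono_of_ae_derivative_nonpos[OF ab _ N])
    show "(L + \<bar>c\<bar> * 1)-lipschitz_on {a..b} (\<lambda>t. f t - c * t)"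
      using lip by (intro lipschitz_intros)
    fix t assume "a < t" "t < b" "t \<notin> N"
    then obtain D where "D \<le> c" "(f has_real_derivative D) (at t)"
      using deriv by blast
    then show "\<exists>D\<le>0. ((\<lambda>t. f t - c * t) has_real_derivative D) (at t)"
      by (intro exI[of _ "D - c"]) (auto intro!: derivative_eq_intros)
  qed
  then show ?thesis by (simp add: algebra_simps)
qed

text \<open>Above the level \<open>d\<close> the function loses at least \<open>e\<close> per unit
  of time, so it comes down to \<open>d\<close> by time \<open>a + (f a - d) / e\<close>. It cannot
  exceed \<open>d\<close> again: after the last time at or below \<open>d\<close> it would have to
  rise while its derivative is negative. This is the Lyapunov criterion applied below to extremal
  queues and loads.\<close>

lemma eventually_le_of_ae_decrease:
  fixes f :: "real \<Rightarrow> real"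
  assumes lip: "L-lipschitz_on {a..} f" and N: "negligible N" and e: "0 < e"
    and deriv: "\<And>t. a < t \<Longrightarrow> t \<notin> N \<Longrightarrow> d < f t \<Longrightarrow> \<exists>D\<le>-e. (f has_real_derivative D) (at t)"
  obtains s where "a \<le> s" "\<And>t. s \<le> t \<Longrightarrow> f t \<le> d"
proof -
  have decr: "f t - f s \<le> - e * (t - s)" if "a \<le> s" "s \<le> t" "\<And>u. s < u \<Longrightarrow> u < t \<Longrightarrow> d < f u" for s t
    using that by (intro ae_derivative_le_imp_diff_le[OF _ lipschitz_on_subset[OF lip] N] deriv) auto
  have "\<exists>s\<ge>a. f s \<le> d"
  proof (rule ccontr)
    assume "\<not> (\<exists>s\<ge>a. f s \<le> d)"
    then have up: "d < f t" if "a \<le> t" for t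
      using that by force
    define t where "t = a + (f a - d) / e"
    have "a \<le> t" using up[of a] e by (simp add: t_def)
    then have "f t - f a \<le> - e * (t - a)"
      using up by (intro decr) auto
    also have "\<dots> = d - f a" using e by (simp add: t_def)
    finally show False using up[OF \<open>a \<le> t\<close>] by simp
  qed
  then obtain s where s: "a \<le> s" "f s \<le> d" by blast
  have "f t \<le> d" if st: "s \<le> t" for t
  proof (rule ccontr)
    assume "\<not> f t \<le> d"
    then have "d < f t" by simp
    moreover have "continuous_on {s..t} f"
      using lipschitz_on_continuous_on[OF lip] by (rule continuous_on_subset) (use s in auto)
    ultimately obtain c where c: "s \<le> c" "c < t" "f c \<le> d" "\<And>u. c < u \<Longrightarrow> u \<le> t \<Longrightarrow> d < f u"
      using continuous_increase_point[of s t f d] st s(2) by metis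
    then have "f t - f c \<le> - e * (t - c)"
      using s by (intro decr) auto
    also have "\<dots> < 0" using e c by simp
    finally show False using c \<open>d < f t\<close> by linarith
  qed
  with s show thesis by (intro that)
qed

section \<open>Maxima of finitely many Lipschitz functions\<close>

lemma has_real_derivative_eq_of_touching:
  fixes f g :: "real \<Rightarrow> real"
  assumes "(f has_real_derivative D) (at t)" "(g has_real_derivative D') (at t)"
    and "a < t" "\<And>s. a < s \<Longrightarrow> g s \<le> f s" "g t = f t"
  shows "D = D'"
proof -
  have "((\<lambda>s. f s - g s) has_real_derivative D - D') (at t)"
    using assms by (intro derivative_intros)
  moreover have "0 < t - a" using assms by simp
  moreover have "\<forall>s. \<bar>t - s\<bar> < t - a \<longrightarrow> f t - g t \<le> f s - g s"
    using assms by (auto simp: abs_less_iff)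
  ultimately have "D - D' = 0"
    by (rule DERIV_local_min)
  then show ?thesis by simp
qed

lemma Max_range_attained:
  fixes f :: "'k::finite \<Rightarrow> 'a::linorder"
  obtains k where "f k = Max (range f)"
proof -
  have "Max (range f) \<in> range f"
    by (rule Max_in) auto
  then obtain k where "Max (range f) = f k"
    by (rule imageE)
  then show thesis using that[of k] by simp
qed

lemma lipschitz_on_Max:
  fixes f :: "'k::finite \<Rightarrow> real \<Rightarrow> real"
  assumes "\<And>k. \<exists>L. L-lipschitz_on S (f k)"
  shows "\<exists>L. L-lipschitz_on S (\<lambda>t. Max (range (\<lambda>k. f k t)))"
proof -
  obtain L where L: "\<And>k. (L k)-lipschitz_on S (f k)"
    using assms by metis
  define M where "M = (\<Sum>k\<in>UNIV. L k)"
  have L0: "0 \<le> L k" for k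
    using lipschitz_on_nonneg[OF L] .
  have LM: "L k \<le> M" for k
    unfolding M_def using L0 by (intro member_le_sum) auto
  have le: "Max (range (\<lambda>k. f k s)) \<le> Max (range (\<lambda>k. f k t)) + M * \<bar>s - t\<bar>" if "s \<in> S" "t \<in> S" for s t
  proof (rule Max.boundedI)
    fix y assume "y \<in> range (\<lambda>k. f k s)"
    then obtain k where y: "y = f k s" by auto
    have "f k s \<le> f k t + L k * \<bar>s - t\<bar>"
      using lipschitz_onD_real[OF L that, of k] by linarith
    also have "\<dots> \<le> Max (range (\<lambda>k. f k t)) + M * \<bar>s - t\<bar>"
      using LM by (intro add_mono mult_right_mono Max_ge) auto
    finally show "y \<le> Max (range (\<lambda>k. f k t)) + M * \<bar>s - t\<bar>" using y by simp
  qed auto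
  have "M-lipschitz_on S (\<lambda>t. Max (range (\<lambda>k. f k t)))"
  proof (rule lipschitz_onI)
    fix s t assume st: "s \<in> S" "t \<in> S"
    show "dist (Max (range (\<lambda>k. f k s))) (Max (range (\<lambda>k. f k t))) \<le> M * dist s t"
      using le[OF st] le[OF st(2,1)] unfolding dist_real_def abs_minus_commute[of t s] by linarith
  next
    show "0 \<le> M" unfolding M_def using L0 by (intro sum_nonneg) auto
  qed
  then show ?thesis ..
qed

text \<open>A component that attains the maximum touches it from below, so where the maximum is
  differentiable, the two derivatives agree. The fluid model only gives sums of derivatives over the
  maximizing set; the common value turns such a sum into a multiple of one number.\<close>

lemma ae_derivative_Max:
  fixes f :: "'k::finite \<Rightarrow> real \<Rightarrow> real"
  assumes "\<And>k. \<exists>L. L-lipschitz_on {a..} (f k)"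
  obtains N where "negligible N"
    "\<And>t. a < t \<Longrightarrow> t \<notin> N \<Longrightarrow> \<exists>D. ((\<lambda>t. Max (range (\<lambda>k. f k t))) has_real_derivative D) (at t) \<and>
       (\<forall>k d. f k t = Max (range (\<lambda>k. f k t)) \<longrightarrow> (f k has_real_derivative d) (at t) \<longrightarrow> d = D)"
proof
  let ?F = "\<lambda>t. Max (range (\<lambda>k. f k t))"
  obtain L where "L-lipschitz_on {a..} ?F"
    using lipschitz_on_Max[of "{a..}" f] assms by blast
  then show "negligible {t. a < t \<and> \<not> ?F differentiable at t}"
    by (rule negligible_nondifferentiable_lipschitz)
  fix t assume t: "a < t" "t \<notin> {t. a < t \<and> \<not> ?F differentiable at t}"
  then obtain D where D: "(?F has_real_derivative D) (at t)"
    by (auto simp: real_differentiable_def)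
  moreover have "d = D" if "f k t = ?F t" "(f k has_real_derivative d) (at t)" for k d
    using has_real_derivative_eq_of_touching[OF D that(2) t(1)] that(1) by simp
  ultimately show "\<exists>D. (?F has_real_derivative D) (at t) \<and>
       (\<forall>k d. f k t = ?F t \<longrightarrow> (f k has_real_derivative d) (at t) \<longrightarrow> d = D)"
    by blast
qed

section \<open>A linear equation with vanishing perturbation\<close>

lemma tendsto_0_of_linear_ode:
  fixes z :: "real \<Rightarrow> real"
  assumes lip: "\<exists>L. L-lipschitz_on {0..} z" and m: "0 < m" and h: "(h \<longlongrightarrow> 0) at_top"
    and ode: "\<And>t. 0 < t \<Longrightarrow> (z has_real_derivative (- m * z t + h t)) (at t)"
  shows "(z \<longlongrightarrow> 0) at_top"
proof -
  have upper: "\<forall>\<^sub>F t in at_top. w t \<le> d"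
    if lw: "\<exists>L. L-lipschitz_on {0..} w" and g: "(g \<longlongrightarrow> 0) at_top" and d: "0 < d"
      and ow: "\<And>t. 0 < t \<Longrightarrow> (w has_real_derivative (- m * w t + g t)) (at t)" for w g d
  proof -
    \<comment> \<open>Above the level \<open>d\<close> the restoring term is at least
      \<open>m * d\<close>; once the perturbation is below half of that, \<open>w\<close> falls at
      rate at least \<open>m * d / 2\<close>.\<close>
    have "0 < m * d / 2" using m d by simp
    then have "\<forall>\<^sub>F t in at_top. g t < m * d / 2"
      by (rule order_tendstoD(2)[OF g])
    then obtain T where T: "\<And>t. T \<le> t \<Longrightarrow> g t < m * d / 2"
      by (auto simp: eventually_at_top_linorder)
    obtain L where L: "L-lipschitz_on {0..} w" using lw by blast
    obtain s where "\<And>t. s \<le> t \<Longrightarrow> w t \<le> d"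
    proof (rule eventually_le_of_ae_decrease[OF lipschitz_on_subset[OF L] negligible_empty \<open>0 < m * d / 2\<close>])
      show "{max 0 T..} \<subseteq> {0..}" by auto
      fix t assume t: "max 0 T < t" "d < w t"
      have "m * d \<le> m * w t" using m t by (intro mult_left_mono) auto
      then show "\<exists>D\<le>- (m * d / 2). (w has_real_derivative D) (at t)"
        using T[of t] t ow[of t] by (intro exI[of _ "- m * w t + g t"]) auto
    qed blast
    then show ?thesis by (auto simp: eventually_at_top_linorder)
  qed
  show ?thesis
  proof (rule tendstoI)
    fix e :: real assume "0 < e"
    then have e2: "0 < e / 2" by simp
    have lm: "\<exists>L. L-lipschitz_on {0..} (\<lambda>t. - z t)" using lip by simp
    have gm: "((\<lambda>t. - h t) \<longlongrightarrow> 0) at_top" using tendsto_minus[OF h] by simp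
    have om: "((\<lambda>t. - z t) has_real_derivative (- m * - z t + - h t)) (at t)" if "0 < t" for t
      using DERIV_minus[OF ode[OF that]] by (simp add: algebra_simps)
    have "\<forall>\<^sub>F t in at_top. z t \<le> e / 2 \<and> - z t \<le> e / 2"
      using upper[OF lip h e2 ode] upper[OF lm gm e2 om] by (rule eventually_conj)
    then show "\<forall>\<^sub>F t in at_top. dist (z t) 0 < e"
      by eventually_elim (use \<open>0 < e\<close> in \<open>auto simp: dist_real_def abs_less_iff\<close>)
  qed
qed

section \<open>Flows on the activity graph\<close>

lemma sum_pools_of:
  fixes z :: "'i \<Rightarrow> 'j::finite \<Rightarrow> 'a::comm_monoid_add"
  assumes "\<And>j. (i, j) \<notin> E \<Longrightarrow> z i j = 0"
  shows "(\<Sum>j\<in>pools_of E i. z i j) = (\<Sum>j\<in>UNIV. z i j)"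
  by (rule sum.mono_neutral_left) (auto simp: pools_of_def assms)

lemma sum_types_of:
  fixes z :: "'i::finite \<Rightarrow> 'j \<Rightarrow> 'a::comm_monoid_add"
  assumes "\<And>i. (i, j) \<notin> E \<Longrightarrow> z i j = 0"
  shows "(\<Sum>i\<in>types_of E j. z i j) = (\<Sum>i\<in>UNIV. z i j)"
  by (rule sum.mono_neutral_left) (auto simp: types_of_def assms)

text \<open>Extension by zero replaces sums over neighbours by sums over all indices, which can be
  swapped freely. The value type is left open because eigenvectors lead to complex flows.\<close>

definition supported_on :: "('i \<times> 'j) set \<Rightarrow> ('i \<Rightarrow> 'j \<Rightarrow> 'a::zero) \<Rightarrow> bool" where
  "supported_on E z \<longleftrightarrow> (\<forall>i j. (i, j) \<notin> E \<longrightarrow> z i j = 0)"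

lemma supported_onD: "supported_on E z \<Longrightarrow> (i, j) \<notin> E \<Longrightarrow> z i j = 0"
  by (simp add: supported_on_def)

text \<open>A unit of flow on one edge realizes the difference of the point masses at its ends.
  Along a path these differences telescope, so connectedness gives them for any two vertices, and
  every prescription of total zero is a combination of differences with one fixed vertex.\<close>

lemma flow_exists:
  fixes E :: "('i::finite \<times> 'j::finite) set" and r :: "'i \<Rightarrow> real" and c :: "'j \<Rightarrow> real"
  assumes conn: "\<And>u v. (u, v) \<in> (activity_adj E)\<^sup>*"
    and total: "(\<Sum>i\<in>UNIV. r i) = (\<Sum>j\<in>UNIV. c j)"
  shows "\<exists>z. supported_on E z \<and> (\<forall>i. (\<Sum>j\<in>UNIV. z i j) = r i) \<and> (\<forall>j. (\<Sum>i\<in>UNIV. z i j) = c j)"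
proof -
  \<comment> \<open>The sign at the pools makes every edge contribute total zero over all
    vertices.\<close>
  define P where "P f \<longleftrightarrow> (\<exists>z. supported_on E z \<and> (\<forall>i. (\<Sum>j\<in>UNIV. z i j) = f (Inl i)) \<and>
      (\<forall>j. (\<Sum>i\<in>UNIV. z i j) = - f (Inr j)))" for f :: "'i + 'j \<Rightarrow> real"
  have P_add: "P (\<lambda>u. f u + g u)" if Pf: "P f" and Pg: "P g" for f g
  proof -
    obtain z w where "supported_on E z" "\<forall>i. (\<Sum>j\<in>UNIV. z i j) = f (Inl i)" "\<forall>j. (\<Sum>i\<in>UNIV. z i j) = - f (Inr j)"
       "supported_on E w" "\<forall>i. (\<Sum>j\<in>UNIV. w i j) = g (Inl i)" "\<forall>j. (\<Sum>i\<in>UNIV. w i j) = - g (Inr j)"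
      using Pf Pg unfolding P_def by blast
    then show ?thesis
      unfolding P_def by (intro exI[of _ "\<lambda>i j. z i j + w i j"]) (auto simp: supported_on_def sum.distrib)
  qed
  have P_scale: "P (\<lambda>u. a * f u)" if Pf: "P f" for f a
  proof -
    obtain z where "supported_on E z" "\<forall>i. (\<Sum>j\<in>UNIV. z i j) = f (Inl i)" "\<forall>j. (\<Sum>i\<in>UNIV. z i j) = - f (Inr j)"
      using Pf unfolding P_def by blast
    then show ?thesis
      unfolding P_def by (intro exI[of _ "\<lambda>i j. a * z i j"]) (auto simp: supported_on_def sum_distrib_left[symmetric])
  qed
  have P_0: "P (\<lambda>u. 0)"
    unfolding P_def by (intro exI[of _ "\<lambda>i j. 0"]) (auto simp: supported_on_def)
  define d where "d u v w = (of_bool (w = u) - of_bool (w = v) :: real)" for u v w :: "'i + 'j"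
  have P_edge: "P (d (Inl i) (Inr j))" if "(i, j) \<in> E" for i j
    unfolding P_def d_def using that
    by (intro exI[of _ "\<lambda>i' j'. of_bool (i' = i \<and> j' = j)"])
      (auto simp: supported_on_def of_bool_def if_distrib cong: if_cong)
  have P_adj: "P (d u v)" if "(u, v) \<in> activity_adj E" for u v
  proof -
    have flip: "d (Inr j) (Inl i) = (\<lambda>u. (-1) * d (Inl i) (Inr j) u)" for i j
      by (auto simp: d_def)
    show ?thesis
      using that P_edge P_scale[of "d (Inl _) (Inr _)" "-1"] unfolding activity_adj_def
      by (auto simp: flip)
  qed
  have P_d: "P (d u v)" for u v
    using conn[of u v]
  proof (induction rule: rtrancl_induct)
    case base
    then show ?case using P_0 by (simp add: d_def)
  next
    case (step v w)
    have "d u w = (\<lambda>x. d u v x + d v w x)"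
      by (auto simp: d_def)
    then show ?case
      using P_add[OF step.IH P_adj[OF step.hyps(2)]] by simp
  qed
  define f where "f = case_sum r (\<lambda>j. - c j)"
  define u0 :: 'i where "u0 = undefined"
  have P_sum: "P (\<lambda>w. \<Sum>u\<in>A. f u * d u (Inl u0) w)" if "finite A" for A
    using that
  proof (induction rule: finite_induct)
    case empty
    then show ?case using P_0 by simp
  next
    case (insert x F)
    then show ?case
      using P_add[OF P_scale[OF P_d[of x "Inl u0"], of "f x"] insert.IH] by simp
  qed
  have "(\<Sum>u\<in>UNIV. f u) = 0"
    using total by (simp add: f_def UNIV_Plus_UNIV[symmetric] sum.Plus sum_negf del: UNIV_Plus_UNIV)
  \<comment> \<open>As the \<open>f u\<close> sum to zero, the masses collected at
    \<open>Inl u0\<close> cancel.\<close>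
  moreover have "f u * d u (Inl u0) w = (if u = w then f u else 0) - f u * of_bool (w = Inl u0)" for u w
    by (auto simp: d_def)
  ultimately have "(\<Sum>u\<in>UNIV. f u * d u (Inl u0) w) = f w" for w
    by (simp add: sum_subtractf sum_distrib_right[symmetric])
  then have "P f"
    using P_sum[of UNIV] by simp
  then show ?thesis
    by (simp add: P_def f_def)
qed

section \<open>Consequences of complete resource pooling\<close>

locale pooled_network =
  fixes lam :: "'i::finite \<Rightarrow> real" and bet :: "'j::finite \<Rightarrow> real"
    and mu l :: "'i \<Rightarrow> 'j \<Rightarrow> real" and rho :: real and m :: "'j \<Rightarrow> real"
    and E :: "('i \<times> 'j) set"
  assumes lam_pos: "\<And>i. 0 < lam i" and bet_pos: "\<And>j. 0 < bet j"
    and crp: "complete_resource_pooling lam bet mu l rho"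
    and m_pos: "\<And>j. 0 < m j" and mu_eq: "\<And>i j. (i, j) \<in> E \<Longrightarrow> mu i j = m j"
    and E_eq: "E = basic_activities l"
begin

lemma
  shows feasible: "spp_feasible lam bet mu l rho"
    and optimal: "spp_feasible lam bet mu l' r' \<Longrightarrow> rho \<le> r'"
    and unique: "spp_feasible lam bet mu l' rho \<Longrightarrow> l' = l"
    and connected: "(u, v) \<in> (activity_adj E)\<^sup>*"
  using crp unfolding complete_resource_pooling_def spp_optimal_def tree_graph_def E_eq by blast+

lemma in_E_iff: "(i, j) \<in> E \<longleftrightarrow> 0 < l i j"
  by (simp add: E_eq basic_activities_def)

lemma l_nonneg: "0 \<le> l i j"
  using feasible by (simp add: spp_feasible_def)

lemma l_supported: "supported_on E l"
  using l_nonneg by (auto simp: supported_on_def in_E_iff order.antisym not_less)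

lemma l_row: "(\<Sum>j\<in>UNIV. l i j) = lam i"
  using feasible by (simp add: spp_feasible_def)

lemma l_min: obtains d where "0 < d" "\<And>i j. (i, j) \<in> E \<Longrightarrow> d \<le> l i j"
proof
  \<comment> \<open>The element 1 makes the minimum meaningful without first showing that
    \<open>E\<close> is nonempty.\<close>
  let ?A = "insert 1 ((\<lambda>(i, j). l i j) ` E)"
  show "0 < Min ?A"
    by (subst Min_gr_iff) (auto simp: in_E_iff)
  show "Min ?A \<le> l i j" if "(i, j) \<in> E" for i j
    using that by (intro Min_le) (auto intro: rev_image_eqI)
qed

lemma pool_load:
  assumes "supported_on E z"
  shows "(\<Sum>i\<in>UNIV. z i j / (bet j * mu i j)) = (\<Sum>i\<in>UNIV. z i j) / (bet j * m j)"
  unfolding sum_divide_distrib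
proof (rule sum.cong)
  fix i
  show "z i j / (bet j * mu i j) = z i j / (bet j * m j)"
    using supported_onD[OF assms, of i j] mu_eq[of i j] by (cases "(i, j) \<in> E") auto
qed simp

lemma feasible_iff:
  assumes z: "supported_on E z"
  shows "spp_feasible lam bet mu z r \<longleftrightarrow> (\<forall>i j. 0 \<le> z i j) \<and> (\<forall>i. (\<Sum>j\<in>UNIV. z i j) = lam i) \<and>
    (\<forall>j. (\<Sum>i\<in>UNIV. z i j) / (bet j * m j) \<le> r)"
proof -
  have "z i j = 0" if "mu i j = 0" for i j
    using that mu_eq[of i j] m_pos[of j] supported_onD[OF z, of i j] by fastforce
  then show ?thesis
    unfolding spp_feasible_def pool_load[OF z] by blast
qed

lemma perturb:
  assumes z: "supported_on E z"
  obtains e where "0 < e" "e < 1" "\<And>i j. 0 \<le> l i j + e * z i j"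
proof -
  obtain d where d: "0 < d" "\<And>i j. (i, j) \<in> E \<Longrightarrow> d \<le> l i j"
    using l_min by blast
  define B where "B = (\<Sum>i\<in>UNIV. \<Sum>j\<in>UNIV. \<bar>z i j\<bar>) + 1"
  have B: "\<bar>z i j\<bar> \<le> B" for i j
  proof -
    have "\<bar>z i j\<bar> \<le> (\<Sum>j\<in>UNIV. \<bar>z i j\<bar>)"
      by (intro member_le_sum) auto
    also have "\<dots> \<le> (\<Sum>i\<in>UNIV. \<Sum>j\<in>UNIV. \<bar>z i j\<bar>)"
      by (rule member_le_sum[of i UNIV "\<lambda>i. \<Sum>j\<in>UNIV. \<bar>z i j\<bar>"]) (auto intro: sum_nonneg)
    finally show ?thesis by (simp add: B_def)
  qed
  have B_pos: "0 < B"
    unfolding B_def by (intro add_nonneg_pos sum_nonneg) auto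
  \<comment> \<open>\<open>d / B\<close> keeps the basic entries nonnegative; the cap
    \<open>1 / 2\<close> lets \<open>e\<close> serve as the weight of a convex combination in
    \<open>l_col\<close>.\<close>
  define e where "e = min (1 / 2) (d / B)"
  have e: "0 < e" "e < 1" "e * B \<le> d"
    using d B_pos by (auto simp: e_def min_def field_simps)
  have "0 \<le> l i j + e * z i j" for i j
  proof (cases "(i, j) \<in> E")
    case True
    have "e * \<bar>z i j\<bar> \<le> e * B"
      using B e by (intro mult_left_mono) auto
    also have "\<dots> \<le> d" by (rule e(3))
    finally have "\<bar>e * z i j\<bar> \<le> d"
      using e(1) by (simp add: abs_mult)
    then show ?thesis
      using d(2)[OF True] by linarith
  qed (use l_nonneg supported_onD[OF z] in simp)
  with e show thesis by (intro that)
qed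

text \<open>A small move from \<open>l\<close> along \<open>z\<close> changes neither row totals nor
  pool loads, so it gives another optimal plan, and by uniqueness the same one.\<close>

lemma zero_of_zero_sums:
  assumes z: "supported_on E z" and rows: "\<And>i. (\<Sum>j\<in>UNIV. z i j) = 0" and cols: "\<And>j. (\<Sum>i\<in>UNIV. z i j) = 0"
  shows "z i j = (0::real)"
proof -
  obtain e where e: "0 < e" "e < 1" "\<And>i j. 0 \<le> l i j + e * z i j"
    using perturb[OF z] by blast
  let ?l = "\<lambda>i j. l i j + e * z i j"
  have s: "supported_on E ?l"
    using z l_supported by (auto simp: supported_on_def)
  have "spp_feasible lam bet mu ?l rho"
    using feasible e unfolding feasible_iff[OF s] feasible_iff[OF l_supported]
    by (simp add: sum.distrib sum_distrib_left[symmetric] rows cols)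
  then have "?l = l" by (rule unique)
  then have "l i j + e * z i j = l i j" by metis
  then show ?thesis using e by simp
qed

lemma zero_of_zero_sums_complex:
  fixes z :: "'i \<Rightarrow> 'j \<Rightarrow> complex"
  assumes z: "supported_on E z" and rows: "\<And>i. (\<Sum>j\<in>UNIV. z i j) = 0" and cols: "\<And>j. (\<Sum>i\<in>UNIV. z i j) = 0"
  shows "z i j = 0"
proof -
  have "Re (z i j) = 0"
    by (rule zero_of_zero_sums[of "\<lambda>i j. Re (z i j)"])
      (use z in \<open>auto simp: supported_on_def Re_sum[symmetric] rows cols simp del: Re_sum\<close>)
  moreover have "Im (z i j) = 0"
    by (rule zero_of_zero_sums[of "\<lambda>i j. Im (z i j)"])
      (use z in \<open>auto simp: supported_on_def Im_sum[symmetric] rows cols simp del: Im_sum\<close>)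
  ultimately show ?thesis by (simp add: complex_eq_iff)
qed

text \<open>\<open>r\<close> is the average load, weighted by capacity. If some pool were loaded
  below \<open>rho\<close>, then \<open>r < rho\<close>, and a small flow with zero row totals,
  available by connectedness, would pull all loads towards \<open>r\<close> and push their maximum
  below the optimum.\<close>

lemma l_col: "(\<Sum>i\<in>UNIV. l i j) = rho * (bet j * m j)"
proof -
  have w: "0 < bet j * m j" for j
    using bet_pos m_pos by simp
  define W where "W = (\<Sum>j\<in>UNIV. bet j * m j)"
  define s where "s j = (\<Sum>i\<in>UNIV. l i j)" for j
  define r where "r = (\<Sum>j\<in>UNIV. s j) / W"
  have W: "0 < W" unfolding W_def by (intro sum_pos) (use w in auto)
  have le: "s j \<le> rho * (bet j * m j)" for j
    using feasible w[of j] unfolding feasible_iff[OF l_supported] s_def by (simp add: divide_le_eq)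
  have "(\<Sum>i\<in>UNIV. (0::real)) = (\<Sum>j\<in>UNIV. r * (bet j * m j) - s j)"
  proof -
    have "(\<Sum>j\<in>UNIV. r * (bet j * m j) - s j) = r * W - (\<Sum>j\<in>UNIV. s j)"
      by (simp only: sum_subtractf W_def sum_distrib_left)
    then show ?thesis using W by (simp add: r_def)
  qed
  then obtain z where z: "supported_on E z" "\<And>i. (\<Sum>j\<in>UNIV. z i j) = 0"
      "\<And>j. (\<Sum>i\<in>UNIV. z i j) = r * (bet j * m j) - s j"
    using flow_exists[OF connected, of "\<lambda>i. 0"] by blast
  obtain e where e: "0 < e" "e < 1" "\<And>i j. 0 \<le> l i j + e * z i j"
    using perturb[OF z(1)] by blast
  let ?l = "\<lambda>i j. l i j + e * z i j"
  have supp: "supported_on E ?l"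
    using z l_supported by (auto simp: supported_on_def)
  have col: "(\<Sum>i\<in>UNIV. ?l i j) = (1 - e) * s j + e * (r * (bet j * m j))" for j
    by (simp add: sum.distrib sum_distrib_left[symmetric] z s_def algebra_simps)
  have "spp_feasible lam bet mu ?l ((1 - e) * rho + e * r)"
    unfolding feasible_iff[OF supp]
  proof (intro conjI allI)
    fix j
    have "(1 - e) * s j \<le> (1 - e) * (rho * (bet j * m j))"
      using le e by (intro mult_left_mono) auto
    then show "(\<Sum>i\<in>UNIV. ?l i j) / (bet j * m j) \<le> (1 - e) * rho + e * r"
      unfolding col pos_divide_le_eq[OF w] by (simp add: algebra_simps)
  qed (use e z l_row in \<open>auto simp: sum.distrib sum_distrib_left[symmetric]\<close>)
  then have "rho \<le> (1 - e) * rho + e * r"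
    by (rule optimal)
  then have "rho \<le> r"
    using e by (simp add: algebra_simps)
  then have "rho * W \<le> (\<Sum>j\<in>UNIV. s j)"
    using W by (simp add: r_def le_divide_eq)
  then have "(\<Sum>j\<in>UNIV. rho * (bet j * m j) - s j) \<le> 0"
    by (simp add: W_def sum_subtractf sum_distrib_left)
  moreover have "0 \<le> rho * (bet j * m j) - s j" for j
    using le by simp
  ultimately have "\<forall>j\<in>UNIV. rho * (bet j * m j) - s j = 0"
    by (subst sum_nonneg_eq_0_iff[symmetric]) (auto intro!: order.antisym sum_nonneg)
  then show ?thesis by (simp add: s_def)
qed

lemma bm_pos: "0 < bet j * m j"
  using bet_pos m_pos by simp

lemma sum_bet_pos: "0 < (\<Sum>j\<in>UNIV. bet j)"
  by (intro sum_pos) (auto simp: bet_pos)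

lemma sum_lam: "(\<Sum>i\<in>UNIV. lam i) = rho * (\<Sum>j\<in>UNIV. bet j * m j)"
proof -
  have "(\<Sum>i\<in>UNIV. lam i) = (\<Sum>j\<in>UNIV. \<Sum>i\<in>UNIV. l i j)"
    by (subst sum.swap) (simp add: l_row)
  then show ?thesis
    by (simp add: l_col sum_distrib_left)
qed

lemma rho_pos: "0 < rho"
proof -
  have "0 < rho * (\<Sum>j\<in>UNIV. bet j * m j)"
    unfolding sum_lam[symmetric] by (intro sum_pos) (auto simp: lam_pos)
  then show ?thesis
    using sum_pos[of UNIV "\<lambda>j. bet j * m j"] bm_pos by (simp add: zero_less_mult_iff)
qed

lemma pools_of_nonempty: "pools_of E i \<noteq> {}"
proof
  assume "pools_of E i = {}"
  then have "(\<Sum>j\<in>UNIV. l i j) = 0"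
    using supported_onD[OF l_supported] by (auto simp: pools_of_def)
  then show False using l_row[of i] lam_pos[of i] by simp
qed

lemma lam_eq_sum_pools:
  "(\<Sum>i\<in>Is. lam i) = (\<Sum>j\<in>(\<Union>i\<in>Is. pools_of E i). \<Sum>i\<in>Is. l i j)"
proof -
  have "(\<Sum>i\<in>Is. lam i) = (\<Sum>j\<in>UNIV. \<Sum>i\<in>Is. l i j)"
    by (subst sum.swap) (simp add: l_row)
  also have "\<dots> = (\<Sum>j\<in>(\<Union>i\<in>Is. pools_of E i). \<Sum>i\<in>Is. l i j)"
    by (rule sum.mono_neutral_right) (auto simp: pools_of_def intro!: sum.neutral supported_onD[OF l_supported])
  finally show ?thesis .
qed

text \<open>Under \<open>l\<close> the types in \<open>Is\<close> are served only by adjacent pools,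
  whose load is exactly \<open>rho\<close>. This gives the drift of the largest queues its
  sign.\<close>

lemma lam_le_capacity: "(\<Sum>i\<in>Is. lam i) \<le> rho * (\<Sum>j\<in>(\<Union>i\<in>Is. pools_of E i). bet j * m j)"
  unfolding lam_eq_sum_pools sum_distrib_left l_col[symmetric]
  by (intro sum_mono sum_mono2) (auto simp: l_nonneg)

text \<open>Consider \<open>Is\<close> together with all its pools. An edge that leaves this set
  cannot start at a type, so it joins one of the pools to a type outside; by connectedness there is
  such an edge.\<close>

lemma boundary_activity:
  assumes "Is \<noteq> {}" "Is \<noteq> UNIV"
  obtains i j where "i \<notin> Is" "j \<in> (\<Union>i\<in>Is. pools_of E i)" "(i, j) \<in> E"
proof -
  obtain a b where ab: "a \<in> Is" "b \<notin> Is" using assms by blast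
  define S where "S = Inl ` Is \<union> Inr ` (\<Union>i\<in>Is. pools_of E i)"
  have "\<exists>u v. (u, v) \<in> activity_adj E \<and> u \<in> S \<and> v \<notin> S"
  proof (rule ccontr)
    assume no: "\<not> ?thesis"
    have "v \<in> S" if "(Inl a, v) \<in> (activity_adj E)\<^sup>*" for v
      using that
    proof induction
      case base
      show ?case using ab by (simp add: S_def)
    next
      case (step u v)
      then show ?case using no by blast
    qed
    from this[OF connected, of "Inl b"] ab show False by (auto simp: S_def)
  qed
  then obtain u v where uv: "(u, v) \<in> activity_adj E" "u \<in> S" "v \<notin> S" by blast
  then obtain i j where "(i, j) \<in> E" "u = Inr j" "v = Inl i"
    by (auto simp: activity_adj_def S_def pools_of_def)
  with uv show thesis by (intro that[of i j]) (auto simp: S_def)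
qed

text \<open>Some pool adjacent to \<open>Is\<close> spends at least \<open>d\<close> of its optimal
  throughput on a type outside \<open>Is\<close>. At \<open>rho = 1\<close> this slack is what makes
  the largest queue fall while the queues are not all equal.\<close>

lemma lam_gap:
  assumes d: "\<And>i j. (i, j) \<in> E \<Longrightarrow> d \<le> l i j" and Is: "Is \<noteq> {}" "Is \<noteq> UNIV"
  shows "(\<Sum>i\<in>Is. lam i) + d \<le> rho * (\<Sum>j\<in>(\<Union>i\<in>Is. pools_of E i). bet j * m j)"
proof -
  let ?P = "\<Union>i\<in>Is. pools_of E i"
  obtain i j where ij: "i \<notin> Is" "j \<in> ?P" "(i, j) \<in> E"
    using boundary_activity[OF Is] by blast
  have "d \<le> (\<Sum>i\<in>-Is. l i j)"
    using d[OF ij(3)] member_le_sum[of i "-Is" "\<lambda>i. l i j"] ij l_nonneg by force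
  also have "\<dots> \<le> (\<Sum>j\<in>?P. \<Sum>i\<in>-Is. l i j)"
    using ij by (intro member_le_sum[of j ?P "\<lambda>j. \<Sum>i\<in>-Is. l i j"]) (auto intro!: sum_nonneg l_nonneg)
  finally have "(\<Sum>i\<in>Is. lam i) + d \<le> (\<Sum>j\<in>?P. (\<Sum>i\<in>Is. l i j) + (\<Sum>i\<in>-Is. l i j))"
    by (simp add: lam_eq_sum_pools sum.distrib)
  also have "\<dots> = (\<Sum>j\<in>?P. \<Sum>i\<in>UNIV. l i j)"
    by (intro sum.cong refl sum.subset_diff[of Is UNIV, unfolded Compl_eq_Diff_UNIV[symmetric], symmetric, THEN trans[OF add.commute]]) auto
  finally show ?thesis
    by (simp add: l_col sum_distrib_left)
qed

text \<open>The counterpart for pools: all work done by \<open>Js\<close> under \<open>l\<close>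
  comes from adjacent types, which may also send work elsewhere.\<close>

lemma capacity_le_lam: "rho * (\<Sum>j\<in>Js. bet j * m j) \<le> (\<Sum>i\<in>(\<Union>j\<in>Js. types_of E j). lam i)"
proof -
  let ?T = "\<Union>j\<in>Js. types_of E j"
  have "rho * (\<Sum>j\<in>Js. bet j * m j) = (\<Sum>i\<in>UNIV. \<Sum>j\<in>Js. l i j)"
    by (subst sum.swap) (simp add: l_col sum_distrib_left)
  also have "\<dots> = (\<Sum>i\<in>?T. \<Sum>j\<in>Js. l i j)"
    by (rule sum.mono_neutral_right) (auto simp: types_of_def intro!: sum.neutral supported_onD[OF l_supported])
  also have "\<dots> \<le> (\<Sum>i\<in>?T. \<Sum>j\<in>UNIV. l i j)"
    by (intro sum_mono sum_mono2) (auto simp: l_nonneg)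
  finally show ?thesis by (simp add: l_row)
qed

text \<open>An injective linear map has a linear left inverse. The coefficients do not depend on the
  matrix \<open>z\<close>, so derivatives and limits in time pass through them.\<close>

lemma left_inverse:
  "\<exists>(A :: 'i \<Rightarrow> 'j \<Rightarrow> 'i \<Rightarrow> real) (B :: 'i \<Rightarrow> 'j \<Rightarrow> 'j \<Rightarrow> real). \<forall>z i j. supported_on E z \<longrightarrow>
      z i j = (\<Sum>k\<in>UNIV. A i j k * (\<Sum>j\<in>UNIV. z k j)) + (\<Sum>k\<in>UNIV. B i j k * (\<Sum>i\<in>UNIV. z i k))"
proof -
  \<comment> \<open>The third component records the entries off \<open>E\<close>: it makes
    \<open>f\<close> injective on the whole space and vanishes on supported matrices.\<close>
  define f :: "real ^ ('i \<times> 'j) \<Rightarrow> (real ^ 'i) \<times> (real ^ 'j) \<times> (real ^ ('i \<times> 'j))" where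
    "f z = (\<chi> i. \<Sum>j\<in>UNIV. z $ (i, j), \<chi> j. \<Sum>i\<in>UNIV. z $ (i, j), \<chi> p. if p \<in> E then 0 else z $ p)" for z
  have lin: "linear f"
    by (rule linearI) (auto simp: f_def vec_eq_iff sum.distrib sum_distrib_left)
  have "inj f"
    unfolding linear_injective_0[OF lin]
  proof (intro allI impI)
    fix z assume "f z = 0"
    then have z: "\<And>i. (\<Sum>j\<in>UNIV. z $ (i, j)) = 0" "\<And>j. (\<Sum>i\<in>UNIV. z $ (i, j)) = 0"
        "\<And>p. p \<notin> E \<Longrightarrow> z $ p = 0"
      by (auto simp: f_def zero_prod_def vec_eq_iff split: if_splits)
    have "z $ (i, j) = 0" for i j
      by (rule zero_of_zero_sums[of "\<lambda>i j. z $ (i, j)"]) (use z in \<open>auto simp: supported_on_def\<close>)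
    then show "z = 0" by (auto simp: vec_eq_iff)
  qed
  then obtain g where g: "linear g" "g \<circ> f = id"
    using linear_injective_left_inverse[OF lin] by blast
  show ?thesis
  proof (intro exI allI impI)
    fix z :: "'i \<Rightarrow> 'j \<Rightarrow> real" and i j
    assume z: "supported_on E z"
    let ?z = "\<chi> p. z (fst p) (snd p)"
    let ?r = "\<chi> i. \<Sum>j\<in>UNIV. z i j" and ?c = "\<chi> j. \<Sum>i\<in>UNIV. z i j"
    have "?z = g (f ?z)"
      using g(2) by (simp add: o_def fun_eq_iff)
    also have "f ?z = (?r, ?c, 0)"
      using z by (auto simp: f_def vec_eq_iff supported_on_def)
    also have "\<dots> = (\<Sum>k\<in>UNIV. ?r $ k *\<^sub>R (axis k 1, 0, 0)) + (\<Sum>k\<in>UNIV. ?c $ k *\<^sub>R (0, axis k 1, 0))"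
    proof -
      have e: "(\<Sum>k\<in>UNIV. v $ k *\<^sub>R axis k 1) = v" for v :: "real ^ 'n::finite"
        using basis_expansion[of v] by (simp add: scalar_mult_eq_scaleR)
      show ?thesis
        by (simp add: prod_eq_iff fst_sum snd_sum e del: vec_lambda_beta)
    qed
    also have "g \<dots> = (\<Sum>k\<in>UNIV. ?r $ k *\<^sub>R g (axis k 1, 0, 0)) + (\<Sum>k\<in>UNIV. ?c $ k *\<^sub>R g (0, axis k 1, 0))"
      by (simp only: linear_add[OF g(1)] linear_sum[OF g(1)] linear_cmul[OF g(1)])
    finally have "?z $ (i, j) = \<dots> $ (i, j)" by simp
    then show "z i j = (\<Sum>k\<in>UNIV. g (axis k 1, 0, 0) $ (i, j) * (\<Sum>j\<in>UNIV. z k j)) +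
        (\<Sum>k\<in>UNIV. g (0, axis k 1, 0) $ (i, j) * (\<Sum>i\<in>UNIV. z i k))"
      by (simp add: mult.commute)
  qed
qed

end

section \<open>Local stability\<close>

lemma poly_det:
  fixes A :: "'a::comm_ring_1 poly ^ 'n ^ 'n"
  shows "poly (det A) x = det (\<chi> i k. poly (A $ i $ k) x)"
  unfolding det_def by (simp add: poly_sum poly_prod)

abbreviation complex_matrix :: "real ^ 'n ^ 'n \<Rightarrow> complex ^ 'n ^ 'n" where
  "complex_matrix A \<equiv> \<chi> i k. complex_of_real (A $ i $ k)"

lemma complex_matrix_mult_component:
  "(complex_matrix A *v v) $ i = (\<Sum>k\<in>UNIV. complex_of_real (A $ i $ k) * v $ k)"
  by (simp add: matrix_vector_mult_def)

lemma det_eq_0_iff_kernel: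
  fixes M :: "'a::field ^ 'n ^ 'n"
  shows "det M = 0 \<longleftrightarrow> (\<exists>v. v \<noteq> 0 \<and> M *v v = 0)"
  using invertible_det_nz[of M] invertible_left_inverse[of M] matrix_left_invertible_ker[of M] by metis

text \<open>Adding all other rows to row \<open>a\<close> turns it into the constant row
  \<open>w\<close>, and \<open>w\<close> factors out.\<close>

lemma det_eq_mult_of_sum_rows:
  fixes M :: "'a::field ^ 'n ^ 'n"
  assumes "\<And>k. (\<Sum>i\<in>UNIV. M $ i $ k) = w"
  shows "det M = w * det (\<chi> i. if i = a then 1 else M $ i)"
proof -
  let ?x = "\<Sum>i\<in>UNIV - {a}. row i M"
  have "det M = det (\<chi> k. if k = a then row a M + ?x else row k M)"
    by (intro det_row_span[symmetric] vec.span_sum vec.span_base) auto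
  also have "row a M + ?x = (\<Sum>i\<in>UNIV. row i M)"
    by (simp add: sum.remove[of UNIV a])
  also have "\<dots> = w *s 1"
    using assms by (simp add: vec_eq_iff row_def sum_component)
  also have "det (\<chi> k. if k = a then w *s 1 else row k M) = w * det (\<chi> k. if k = a then 1 else row k M)"
    by (rule det_row_mul)
  also have "(\<chi> k. if k = a then 1 else row k M) = (\<chi> i. if i = a then 1 else M $ i)"
    by (simp add: vec_eq_iff row_def)
  finally show ?thesis .
qed

text \<open>The columns of \<open>x I - A\<close> all sum to \<open>x\<close>, so the characteristic
  polynomial is \<open>x\<close> times \<open>det N\<close>, where \<open>N\<close> has a row of
  ones. The zero is simple if \<open>det N\<close> does not vanish at 0: a kernel vector there has
  total zero by the row of ones and is annihilated by \<open>A\<close>, so it is zero by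
  \<open>ker\<close>.\<close>

lemma simple_zero_eigenvalue:
  fixes A :: "real ^ 'n ^ 'n"
  assumes cols: "\<And>k. (\<Sum>i\<in>UNIV. A $ i $ k) = 0"
    and ker: "\<And>v. complex_matrix A *v v = 0 \<Longrightarrow> (\<Sum>i\<in>UNIV. v $ i) = 0 \<Longrightarrow> v = 0"
  shows "complex_eigenvalue A 0" and "order 0 (characteristic_poly A) = 1"
proof -
  define a :: 'n where "a = undefined"
  let ?M = "mat [:0, 1:] - (\<chi> i k. [:complex_of_real (A $ i $ k):]) :: complex poly ^ 'n ^ 'n"
  define N where "N = (\<chi> i. if i = a then 1 else ?M $ i)"
  let ?Mx = "\<lambda>x. \<chi> i k. poly (?M $ i $ k) x"
  have Mx: "?Mx x $ i $ k = (if i = k then x else 0) - complex_of_real (A $ i $ k)" for x i k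
    by (simp add: mat_def)
  have sumA: "(\<Sum>i\<in>UNIV. complex_of_real (A $ i $ k)) = 0" for k
    using cols[of k] by (simp flip: of_real_sum)
  have sumM: "(\<Sum>i\<in>UNIV. ?Mx x $ i $ k) = x" for x k
    unfolding Mx by (simp add: sum_subtractf sumA)
  have "poly (det ?M) x = poly ([:0, 1:] * det N) x" for x
  proof -
    have "(\<chi> i k. poly (N $ i $ k) x) = (\<chi> i. if i = a then 1 else ?Mx x $ i)"
      by (simp add: N_def vec_eq_iff)
    then show ?thesis
      unfolding poly_mult poly_det[of ?M] poly_det[of N] det_eq_mult_of_sum_rows[of "?Mx x" x a, OF sumM]
      by simp
  qed
  then have p: "characteristic_poly A = [:0, 1:] * det N"
    unfolding characteristic_poly_def by (intro poly_eq_poly_eq_iff[THEN iffD1] ext)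
  have M0: "?Mx 0 = - complex_matrix A"
    by (simp only: vec_eq_iff Mx) simp
  have neg: "(- complex_matrix A) *v v = - (complex_matrix A *v v)" for v
    by (simp add: vec_eq_iff matrix_vector_mult_def sum_negf)
  have "det (- complex_matrix A) = 0"
    using det_eq_mult_of_sum_rows[of "?Mx 0" 0 a, OF sumM] unfolding M0 by simp
  then obtain v where "v \<noteq> 0" "complex_matrix A *v v = 0"
    unfolding det_eq_0_iff_kernel neg by auto
  then show "complex_eigenvalue A 0"
    unfolding complex_eigenvalue_def by auto
  have "poly (det N) 0 \<noteq> 0"
  proof
    assume "poly (det N) 0 = 0"
    then have "det (\<chi> i k. poly (N $ i $ k) 0) = 0"
      by (simp add: poly_det)
    then obtain v where v: "v \<noteq> 0" "(\<chi> i k. poly (N $ i $ k) 0) *v v = 0"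
      unfolding det_eq_0_iff_kernel by blast
    then have Nv: "(\<Sum>k\<in>UNIV. poly (N $ i $ k) 0 * v $ k) = 0" for i
      by (simp add: vec_eq_iff matrix_vector_mult_def)
    have s: "(\<Sum>k\<in>UNIV. v $ k) = 0"
      using Nv[of a] by (simp add: N_def)
    \<comment> \<open>Away from row \<open>a\<close>, \<open>N\<close> at 0 is minus
      \<open>A\<close>; row \<open>a\<close> follows below because the entries of \<open>A v\<close>
      sum to zero.\<close>
    have ne: "(complex_matrix A *v v) $ i = 0" if "i \<noteq> a" for i
    proof -
      have "(\<Sum>k\<in>UNIV. - complex_of_real (A $ i $ k) * v $ k) = (\<Sum>k\<in>UNIV. poly (N $ i $ k) 0 * v $ k)"
        using that by (intro sum.cong refl) (auto simp: N_def mat_def)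
      then show ?thesis
        using Nv[of i] by (simp add: matrix_vector_mult_def sum_negf)
    qed
    have "(\<Sum>i\<in>UNIV. (complex_matrix A *v v) $ i) = 0"
      unfolding complex_matrix_mult_component by (subst sum.swap) (simp add: sum_distrib_right[symmetric] sumA)
    then have "(complex_matrix A *v v) $ a = 0"
      using ne by (simp add: sum.remove[of UNIV a])
    with ne have "complex_matrix A *v v = 0"
      by (metis vec_eq_iff zero_index)
    then show False using ker s v(1) by blast
  qed
  then have "det N \<noteq> 0" "order 0 (det N) = 0"
    by (auto intro: order_0I)
  moreover have "order 0 [:0, 1::complex:] = 1"
    using order_power_n_n[of "0::complex" 1] by simp
  ultimately show "order 0 (characteristic_poly A) = 1"
    unfolding p by (subst order_mult) auto
qed

section \<open>The linearised dynamics in occupancy coordinates\<close>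

context pooled_network
begin

text \<open>The definite description is legitimate: a solution exists by connectedness, as the
  prescribed row and column sums have the same total, and it is unique by
  \<open>zero_of_zero_sums\<close>.\<close>

lemma
  fixes y :: "real ^ 'i"
  shows occupancy_supported: "supported_on E (occupancy_map E bet y)"
    and occupancy_row: "(\<Sum>j\<in>UNIV. occupancy_map E bet y i j) = y $ i"
    and occupancy_col: "(\<Sum>i\<in>UNIV. occupancy_map E bet y i j) = (\<Sum>i\<in>UNIV. y $ i) / (\<Sum>j\<in>UNIV. bet j) * bet j"
proof -
  define Q where "Q z \<longleftrightarrow> supported_on E z \<and>
      (\<forall>j. (\<Sum>i\<in>UNIV. z i j) = (\<Sum>i\<in>UNIV. y $ i) / (\<Sum>j\<in>UNIV. bet j) * bet j) \<and>
      (\<forall>i. (\<Sum>j\<in>UNIV. z i j) = y $ i)" for z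
  have "((\<forall>i j. (i, j) \<notin> E \<longrightarrow> z i j = 0) \<and>
        (\<forall>j. (\<Sum>i\<in>types_of E j. z i j) = (\<Sum>i\<in>UNIV. y $ i) / (\<Sum>j'\<in>UNIV. bet j') * bet j) \<and>
        (\<forall>i. (\<Sum>j\<in>pools_of E i. z i j) = y $ i)) \<longleftrightarrow> Q z" for z :: "'i \<Rightarrow> 'j \<Rightarrow> real"
    using sum_types_of[of _ E z] sum_pools_of[of _ E z] unfolding Q_def supported_on_def by auto
  then have "occupancy_map E bet y = (THE z. Q z)"
    by (simp add: occupancy_map_def)
  moreover have "\<exists>!z. Q z"
  proof -
    have "(\<Sum>i\<in>UNIV. y $ i) = (\<Sum>j\<in>UNIV. (\<Sum>i\<in>UNIV. y $ i) / (\<Sum>j\<in>UNIV. bet j) * bet j)"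
      unfolding sum_distrib_left[symmetric] using sum_bet_pos by simp
    then have "\<exists>z. Q z"
      using flow_exists[OF connected] unfolding Q_def by fast
    moreover have "z = z'" if "Q z" "Q z'" for z z'
    proof (intro ext)
      fix i j
      have "z i j - z' i j = 0"
        by (rule zero_of_zero_sums[of "\<lambda>i j. z i j - z' i j"])
          (use that in \<open>auto simp: Q_def supported_on_def sum_subtractf\<close>)
      then show "z i j = z' i j" by simp
    qed
    ultimately show ?thesis by blast
  qed
  ultimately have "Q (occupancy_map E bet y)"
    using theI'[of Q] by simp
  then show "supported_on E (occupancy_map E bet y)"
    and "(\<Sum>j\<in>UNIV. occupancy_map E bet y i j) = y $ i"
    and "(\<Sum>i\<in>UNIV. occupancy_map E bet y i j) = (\<Sum>i\<in>UNIV. y $ i) / (\<Sum>j\<in>UNIV. bet j) * bet j"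
    by (auto simp: Q_def)
qed

text \<open>The complex linear extension of \<open>occupancy_map\<close>, given through the standard
  basis: eigenvectors of the real matrices may be complex.\<close>

definition complex_occupancy :: "complex ^ 'i \<Rightarrow> 'i \<Rightarrow> 'j \<Rightarrow> complex" where
  "complex_occupancy v i j = (\<Sum>k\<in>UNIV. complex_of_real (occupancy_map E bet (axis k 1) i j) * v $ k)"

lemma complex_occupancy_supported: "supported_on E (complex_occupancy v)"
  using occupancy_supported by (auto simp: supported_on_def complex_occupancy_def)

lemma complex_occupancy_row: "(\<Sum>j\<in>UNIV. complex_occupancy v i j) = v $ i"
proof -
  have "(\<Sum>j\<in>UNIV. complex_occupancy v i j) =
      (\<Sum>k\<in>UNIV. complex_of_real (\<Sum>j\<in>UNIV. occupancy_map E bet (axis k 1) i j) * v $ k)"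
    unfolding complex_occupancy_def by (subst sum.swap) (simp add: sum_distrib_right)
  also have "\<dots> = (\<Sum>k\<in>UNIV. if k = i then v $ k else 0)"
    unfolding occupancy_row by (intro sum.cong refl) (auto simp: axis_def)
  finally show ?thesis by simp
qed

lemma complex_occupancy_col:
  "(\<Sum>i\<in>UNIV. complex_occupancy v i j) = (\<Sum>i\<in>UNIV. v $ i) / of_real (\<Sum>j\<in>UNIV. bet j) * of_real (bet j)"
proof -
  have "(\<Sum>i\<in>UNIV. complex_occupancy v i j) =
      (\<Sum>k\<in>UNIV. complex_of_real (\<Sum>i\<in>UNIV. occupancy_map E bet (axis k 1) i j) * v $ k)"
    unfolding complex_occupancy_def by (subst sum.swap) (simp add: sum_distrib_right)
  also have "\<dots> = (\<Sum>k\<in>UNIV. complex_of_real (1 / (\<Sum>j\<in>UNIV. bet j) * bet j) * v $ k)"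
    unfolding occupancy_col by (simp add: axis_def)
  also have "\<dots> = complex_of_real (1 / (\<Sum>j\<in>UNIV. bet j) * bet j) * (\<Sum>k\<in>UNIV. v $ k)"
    by (simp only: sum_distrib_left)
  finally show ?thesis by simp
qed

lemma underload_mult:
  "(complex_matrix (underload_matrix E bet mu) *v v) $ i = - (\<Sum>j\<in>UNIV. of_real (m j) * complex_occupancy v i j)"
proof -
  have entry: "underload_matrix E bet mu $ i $ k = - (\<Sum>j\<in>UNIV. m j * occupancy_map E bet (axis k 1) i j)" for k
  proof -
    have z: "(i, j) \<notin> E \<Longrightarrow> occupancy_map E bet (axis k 1) i j = 0" for j
      using supported_onD[OF occupancy_supported] .
    have "(\<Sum>j\<in>pools_of E i. mu i j * occupancy_map E bet (axis k 1) i j) =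
        (\<Sum>j\<in>pools_of E i. m j * occupancy_map E bet (axis k 1) i j)"
      by (intro sum.cong refl) (auto simp: pools_of_def mu_eq)
    then show ?thesis
      using sum_pools_of[of i E "\<lambda>i j. m j * occupancy_map E bet (axis k 1) i j"] z
      by (simp add: underload_matrix_def matrix_def)
  qed
  show ?thesis
    unfolding complex_matrix_mult_component entry complex_occupancy_def
    by (simp add: sum_distrib_left sum_distrib_right sum_negf mult.assoc) (rule sum.swap)
qed

text \<open>
  Since \<open>mu\<close> depends on the pool only, multiplication by \<open>m j\<close> preserves vanishing pool totals, so
  in occupancy coordinates the matrix acts on this subspace diagonally.
\<close>
lemma eigenvalue_of_balanced:
  assumes v: "v \<noteq> 0" "(\<Sum>i\<in>UNIV. v $ i) = 0"
    and eig: "complex_matrix (underload_matrix E bet mu) *v v = w *s v"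
  obtains j where "w = - of_real (m j)"
proof -
  let ?z = "complex_occupancy v"
  have col: "(\<Sum>i\<in>UNIV. ?z i j) = 0" for j
    by (simp add: complex_occupancy_col v)
  \<comment> \<open>The eigenvalue equation is exactly the vanishing of the row sums of this
    matrix.\<close>
  have zero: "(w + of_real (m j)) * ?z i j = 0" for i j
  proof (rule zero_of_zero_sums_complex[of "\<lambda>i j. (w + of_real (m j)) * ?z i j"])
    show "supported_on E (\<lambda>i j. (w + of_real (m j)) * ?z i j)"
      using complex_occupancy_supported[of v] by (auto simp: supported_on_def)
    show "(\<Sum>i\<in>UNIV. (w + of_real (m j)) * ?z i j) = 0" for j
      by (simp add: sum_distrib_left[symmetric] col)
    fix i
    have "- (\<Sum>j\<in>UNIV. of_real (m j) * ?z i j) = w * v $ i"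
      using arg_cong[OF eig, of "\<lambda>v. v $ i"] unfolding underload_mult by simp
    moreover have "(\<Sum>j\<in>UNIV. (w + of_real (m j)) * ?z i j) =
        w * (\<Sum>j\<in>UNIV. ?z i j) + (\<Sum>j\<in>UNIV. of_real (m j) * ?z i j)"
      by (simp add: distrib_right sum.distrib sum_distrib_left)
    ultimately show "(\<Sum>j\<in>UNIV. (w + of_real (m j)) * ?z i j) = 0"
      unfolding complex_occupancy_row by (metis add.commute add.right_inverse)
  qed
  obtain i where "v $ i \<noteq> 0" using v(1) by (auto simp: vec_eq_iff)
  then obtain j where "?z i j \<noteq> 0"
    using complex_occupancy_row[of v i] by (metis sum.neutral)
  with zero[of j i] have "w = - of_real (m j)"
    by (simp add: add_eq_0_iff2)
  then show thesis by (rule that)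
qed

text \<open>Pool totals of the occupancy depend only on the total of \<open>v\<close>. So the row of
  ones is a left eigenvector, and its eigenvalue is minus the \<open>bet\<close>-weighted mean of
  the \<open>m j\<close>.\<close>

lemma sum_underload_mult:
  "(\<Sum>i\<in>UNIV. (complex_matrix (underload_matrix E bet mu) *v v) $ i) =
    - of_real ((\<Sum>j\<in>UNIV. bet j * m j) / (\<Sum>j\<in>UNIV. bet j)) * (\<Sum>i\<in>UNIV. v $ i)"
proof -
  have "(\<Sum>i\<in>UNIV. (complex_matrix (underload_matrix E bet mu) *v v) $ i) =
      - (\<Sum>j\<in>UNIV. of_real (m j) * (\<Sum>i\<in>UNIV. complex_occupancy v i j))"
    unfolding underload_mult sum_negf sum_distrib_left by (subst sum.swap) simp
  also have "\<dots> = - (\<Sum>j\<in>UNIV. of_real (bet j * m j) * ((\<Sum>i\<in>UNIV. v $ i) / of_real (\<Sum>j\<in>UNIV. bet j)))"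
    unfolding complex_occupancy_col by (simp add: mult_ac)
  also have "\<dots> = - of_real (\<Sum>j\<in>UNIV. bet j * m j) * ((\<Sum>i\<in>UNIV. v $ i) / of_real (\<Sum>j\<in>UNIV. bet j))"
    by (simp add: sum_distrib_right sum_divide_distrib)
  finally show ?thesis by simp
qed

lemma sum_bm_pos: "0 < (\<Sum>j\<in>UNIV. bet j * m j)"
  by (intro sum_pos) (auto simp: bm_pos)

text \<open>An eigenvector of nonzero total has the eigenvalue of the left eigenvector of ones; for
  all others the eigenvalue is some \<open>- m j\<close>.\<close>

theorem underload_stable: "underload_stable (underload_matrix E bet mu)"
  unfolding underload_stable_def
proof (intro allI impI)
  fix w assume "complex_eigenvalue (underload_matrix E bet mu) w"
  then obtain v where v: "v \<noteq> 0" and eig: "complex_matrix (underload_matrix E bet mu) *v v = w *s v"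
    by (auto simp: complex_eigenvalue_def)
  show "Re w < 0"
  proof (cases "(\<Sum>i\<in>UNIV. v $ i) = 0")
    case True
    then obtain j where "w = - of_real (m j)"
      using eigenvalue_of_balanced[OF v _ eig] by blast
    then show ?thesis using m_pos[of j] by simp
  next
    case False
    have "w * (\<Sum>i\<in>UNIV. v $ i) = - of_real ((\<Sum>j\<in>UNIV. bet j * m j) / (\<Sum>j\<in>UNIV. bet j)) * (\<Sum>i\<in>UNIV. v $ i)"
      using sum_underload_mult[of v] unfolding eig by (simp add: sum_distrib_left)
    then have "w = - of_real ((\<Sum>j\<in>UNIV. bet j * m j) / (\<Sum>j\<in>UNIV. bet j))"
      using False by (simp only: mult_cancel_right) simp
    then have "Re w = - ((\<Sum>j\<in>UNIV. bet j * m j) / (\<Sum>j\<in>UNIV. bet j))"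
      by (simp only: uminus_complex.sel Re_complex_of_real)
    then show ?thesis
      using sum_bm_pos sum_bet_pos by simp
  qed
qed

lemma critical_mult:
  "(complex_matrix (critical_matrix E bet mu) *v v) $ i =
    (complex_matrix (underload_matrix E bet mu) *v v) $ i
     - 1 / of_nat CARD('i) * (\<Sum>k\<in>UNIV. (complex_matrix (underload_matrix E bet mu) *v v) $ k)"
proof -
  have "(\<Sum>k\<in>UNIV. (complex_matrix (underload_matrix E bet mu) *v v) $ k) =
      (\<Sum>k\<in>UNIV. (\<Sum>i\<in>UNIV. of_real (underload_matrix E bet mu $ i $ k)) * v $ k)"
    unfolding complex_matrix_mult_component sum_distrib_right by (rule sum.swap)
  moreover have "complex_of_real (critical_matrix E bet mu $ i $ k) = of_real (underload_matrix E bet mu $ i $ k)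
      - 1 / of_nat CARD('i) * (\<Sum>x\<in>UNIV. of_real (underload_matrix E bet mu $ x $ k))" for k
    by (simp add: critical_matrix_def)
  ultimately show ?thesis
    by (simp only: complex_matrix_mult_component[of _ _ i] left_diff_distrib sum_subtractf mult.assoc sum_distrib_left[symmetric])
qed

lemma critical_cols: "(\<Sum>i\<in>UNIV. critical_matrix E bet mu $ i $ k) = 0"
  by (simp add: critical_matrix_def sum_subtractf)

text \<open>\<open>underload_matrix\<close> preserves total zero, so the centring in
  \<open>critical_matrix\<close> subtracts nothing from such vectors.\<close>

lemma critical_mult_balanced:
  assumes "(\<Sum>i\<in>UNIV. v $ i) = 0"
  shows "complex_matrix (critical_matrix E bet mu) *v v = complex_matrix (underload_matrix E bet mu) *v v"
  using sum_underload_mult[of v] assms by (simp add: vec_eq_iff critical_mult del: vec_lambda_beta)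

text \<open>Zero column sums force total zero on every eigenvector of a nonzero eigenvalue, and
  there the matrix agrees with \<open>underload_matrix\<close>. The same agreement excludes nonzero
  kernel vectors of total zero, which makes 0 simple.\<close>

theorem critical_stable: "critical_stable (critical_matrix E bet mu)"
proof -
  let ?A = "critical_matrix E bet mu"
  have neg: "Re w < 0"
    if v: "v \<noteq> 0" "(\<Sum>i\<in>UNIV. v $ i) = 0" and eig: "complex_matrix ?A *v v = w *s v" for v w
  proof -
    obtain j where "w = - of_real (m j)"
      using eigenvalue_of_balanced[OF v] eig unfolding critical_mult_balanced[OF v(2)] by blast
    then show ?thesis using m_pos[of j] by simp
  qed
  have ker: "v = 0" if "complex_matrix ?A *v v = 0" "(\<Sum>i\<in>UNIV. v $ i) = 0" for v
    using neg[of v 0] that by auto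
  have "Re w < 0" if "complex_eigenvalue ?A w" "w \<noteq> 0" for w
  proof -
    obtain v where v: "v \<noteq> 0" and eig: "complex_matrix ?A *v v = w *s v"
      using \<open>complex_eigenvalue ?A w\<close> by (auto simp: complex_eigenvalue_def)
    have "w * (\<Sum>i\<in>UNIV. v $ i) = (\<Sum>i\<in>UNIV. (complex_matrix ?A *v v) $ i)"
      unfolding eig by (simp add: sum_distrib_left)
    also have "\<dots> = (\<Sum>k\<in>UNIV. of_real (\<Sum>i\<in>UNIV. ?A $ i $ k) * v $ k)"
      unfolding complex_matrix_mult_component of_real_sum sum_distrib_right by (rule sum.swap)
    also have "\<dots> = 0" by (simp add: critical_cols del: of_real_sum)
    finally show ?thesis using neg v eig \<open>w \<noteq> 0\<close> by simp
  qed
  then show ?thesis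
    unfolding critical_stable_def
    using simple_zero_eigenvalue[of ?A] critical_cols ker by blast
qed

end

section \<open>Fluid models\<close>

lemma lipschitz_on_cmult_ex: "\<exists>L. L-lipschitz_on S f \<Longrightarrow> \<exists>L. L-lipschitz_on S (\<lambda>t. c * f t)"
  for f :: "'a::metric_space \<Rightarrow> real"
  using lipschitz_on_cmult_real by blast

lemma lipschitz_on_add_ex:
  "\<exists>L. L-lipschitz_on S f \<Longrightarrow> \<exists>L. L-lipschitz_on S g \<Longrightarrow> \<exists>L. L-lipschitz_on S (\<lambda>t. f t + g t)"
  for f g :: "'a::metric_space \<Rightarrow> real"
  using lipschitz_on_add by blast

lemma lipschitz_on_const_ex: "\<exists>L. L-lipschitz_on S (\<lambda>t. c)"
  using lipschitz_on_constant by blast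

lemma lipschitz_on_sum_ex:
  fixes f :: "'k \<Rightarrow> 'a::metric_space \<Rightarrow> real"
  assumes "\<And>k. k \<in> A \<Longrightarrow> \<exists>L. L-lipschitz_on S (f k)"
  shows "\<exists>L. L-lipschitz_on S (\<lambda>t. \<Sum>k\<in>A. f k t)"
  using assms
  by (induction A rule: infinite_finite_induct) (auto intro!: lipschitz_on_const_ex lipschitz_on_add_ex)

lemma antimono_tendsto_at_top:
  fixes f :: "real \<Rightarrow> real"
  assumes anti: "\<And>s t. a \<le> s \<Longrightarrow> s \<le> t \<Longrightarrow> f t \<le> f s" and bound: "\<And>t. a \<le> t \<Longrightarrow> b \<le> f t"
  obtains c where "b \<le> c" "(f \<longlongrightarrow> c) at_top"
proof
  let ?c = "Inf (f ` {a..})"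
  have bdd: "bdd_below (f ` {a..})"
    using bound by (auto intro!: bdd_belowI[of _ b])
  show "b \<le> ?c"
    using bound by (intro cInf_greatest) auto
  show "(f \<longlongrightarrow> ?c) at_top"
  proof (rule order_tendstoI)
    fix u assume "u < ?c"
    then have "u < f t" if "a \<le> t" for t
      using cInf_lower[OF _ bdd, of "f t"] that by force
    then show "\<forall>\<^sub>F t in at_top. u < f t"
      by (auto simp: eventually_at_top_linorder)
  next
    fix u assume "?c < u"
    then obtain s where "a \<le> s" "f s < u"
      using cInf_less_iff[OF _ bdd] by auto
    then have "f t < u" if "s \<le> t" for t
      using anti[of s t] that by linarith
    then show "\<forall>\<^sub>F t in at_top. f t < u"
      by (auto simp: eventually_at_top_linorder)
  qed
qed

text \<open>\<open>n\<close> will be the number of queues that share the maximum; the bound in terms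
  of \<open>K\<close> is uniform in that number.\<close>

lemma le_neg_divide_of_mult_le:
  fixes D e :: real
  assumes "n * D \<le> - e" "0 < n" "n \<le> K" "0 \<le> e"
  shows "D \<le> - (e / K)"
proof -
  have "D \<le> - e / n"
    using assms by (simp only: pos_le_divide_eq mult.commute)
  moreover have "e / K \<le> e / n"
    using assms by (intro divide_left_mono) auto
  ultimately show ?thesis by simp
qed

locale network_fluid_model = pooled_network lam bet mu l rho m E
  for lam :: "'i::finite \<Rightarrow> real" and bet :: "'j::finite \<Rightarrow> real"
    and mu l :: "'i \<Rightarrow> 'j \<Rightarrow> real" and rho :: real and m :: "'j \<Rightarrow> real"
    and E :: "('i \<times> 'j) set" +
  fixes a x q :: "'i \<Rightarrow> real \<Rightarrow> real" and psi :: "'i \<Rightarrow> 'j \<Rightarrow> real \<Rightarrow> real" and load :: "'j \<Rightarrow> real \<Rightarrow> real"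
  assumes fluid: "fluid_model E lam bet mu a x q psi load"
begin

text \<open>\<open>psi\<close> is arbitrary off \<open>E\<close>, hence the zero extension here and
  in \<open>docc\<close>.\<close>

definition occ :: "'i \<Rightarrow> 'j \<Rightarrow> real \<Rightarrow> real" where
  "occ i j t = (if (i, j) \<in> E then psi i j t else 0)"

definition docc :: "'i \<Rightarrow> 'j \<Rightarrow> real \<Rightarrow> real" where
  "docc i j t = (if (i, j) \<in> E then deriv (psi i j) t else 0)"

text \<open>The derivative of \<open>x i\<close> minus that of its occupancies;
  \<open>q_deriv\<close> identifies it with the derivative of the queue at regular points.\<close>

definition dq :: "'i \<Rightarrow> real \<Rightarrow> real" where
  "dq i t = lam i - (\<Sum>j\<in>UNIV. m j * occ i j t) - (\<Sum>j\<in>UNIV. docc i j t)"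

lemma
  shows lip_x: "\<exists>L. L-lipschitz_on {0..} (x i)"
    and lip_q: "\<exists>L. L-lipschitz_on {0..} (q i)"
    and lip_load: "\<exists>L. L-lipschitz_on {0..} (load j)"
    and lip_psi: "(i, j) \<in> E \<Longrightarrow> \<exists>L. L-lipschitz_on {0..} (psi i j)"
  using fluid unfolding fluid_model_def by fast+

lemma
  assumes "0 \<le> t"
  shows q_nonneg: "0 \<le> q i t"
    and load_le_1: "load j t \<le> 1"
    and x_eq_q_plus: "x i t = q i t + (\<Sum>j\<in>pools_of E i. psi i j t)"
    and x_eq_integral: "x i t = x i 0 + lam i * t - (\<Sum>j\<in>pools_of E i. integral {0..t} (\<lambda>s. mu i j * psi i j s))"
    and load_eq: "load j t = 1 / bet j * (\<Sum>i\<in>types_of E j. psi i j t)"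
    and load_eq_1: "(i, j) \<in> E \<Longrightarrow> 0 < q i t \<Longrightarrow> load j t = 1"
proof -
  show "0 \<le> q i t" "load j t \<le> 1" "x i t = q i t + (\<Sum>j\<in>pools_of E i. psi i j t)"
      "load j t = 1 / bet j * (\<Sum>i\<in>types_of E j. psi i j t)"
    using fluid assms unfolding fluid_model_def by blast+
  have "x i t = x i 0 + a i t - (\<Sum>j\<in>pools_of E i. integral {0..t} (\<lambda>s. mu i j * psi i j s))"
      "a i t = lam i * t"
    using fluid assms unfolding fluid_model_def by blast+
  then show "x i t = x i 0 + lam i * t - (\<Sum>j\<in>pools_of E i. integral {0..t} (\<lambda>s. mu i j * psi i j s))"
    by simp
  have "(\<exists>i\<in>types_of E j. 0 < q i t) \<longrightarrow> load j t = 1"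
    using fluid assms unfolding fluid_model_def by blast
  then show "(i, j) \<in> E \<Longrightarrow> 0 < q i t \<Longrightarrow> load j t = 1"
    by (auto simp: types_of_def)
qed

lemma occ_supported: "supported_on E (\<lambda>i j. occ i j t)"
  by (simp add: supported_on_def occ_def)

lemma sum_pools_occ: "(\<Sum>j\<in>pools_of E i. psi i j t) = (\<Sum>j\<in>UNIV. occ i j t)"
  by (subst sum_pools_of[of i E "\<lambda>i j. occ i j t", symmetric])
    (auto simp: occ_def pools_of_def intro!: sum.cong)

lemma occ_row: "0 \<le> t \<Longrightarrow> (\<Sum>j\<in>UNIV. occ i j t) = x i t - q i t"
  using x_eq_q_plus by (simp add: sum_pools_occ)

lemma occ_col: "0 \<le> t \<Longrightarrow> (\<Sum>i\<in>UNIV. occ i j t) = bet j * load j t"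
proof -
  assume t: "0 \<le> t"
  have "(\<Sum>i\<in>types_of E j. psi i j t) = (\<Sum>i\<in>UNIV. occ i j t)"
    by (subst sum_types_of[of j E "\<lambda>i j. occ i j t", symmetric])
      (auto simp: occ_def types_of_def intro!: sum.cong)
  then show ?thesis
    using load_eq[OF t, of j] bet_pos[of j] by simp
qed

text \<open>The integrands are continuous, so the derivative exists at every positive time and not
  only at regular points. \<open>occ_tendsto\<close> relies on this.\<close>

lemma x_deriv:
  assumes t: "0 < t"
  shows "(x i has_real_derivative (lam i - (\<Sum>j\<in>UNIV. m j * occ i j t))) (at t)"
proof -
  have int: "((\<lambda>s. integral {0..s} (\<lambda>s. mu i j * psi i j s)) has_real_derivative mu i j * psi i j t) (at t)"
    if "j \<in> pools_of E i" for j
  proof -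
    have "(i, j) \<in> E" using that by (simp add: pools_of_def)
    then obtain L where "L-lipschitz_on {0..} (psi i j)"
      using lip_psi by blast
    then have "continuous_on {0..} (psi i j)"
      by (rule lipschitz_on_continuous_on)
    then have "continuous_on {0..t + 1} (\<lambda>s. mu i j * psi i j s)"
      by (intro continuous_intros) (auto intro: continuous_on_subset)
    then have "((\<lambda>s. integral {0..s} (\<lambda>s. mu i j * psi i j s)) has_real_derivative mu i j * psi i j t) (at t within {0..t + 1})"
      using t by (intro integral_has_real_derivative) auto
    moreover have "at t within {0..t + 1} = at t"
      using t by (intro at_within_interior) (auto simp: interior_atLeastAtMost_real)
    ultimately show ?thesis by simp
  qed
  have "(\<Sum>j\<in>pools_of E i. mu i j * psi i j t) = (\<Sum>j\<in>pools_of E i. m j * occ i j t)"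
    by (intro sum.cong) (auto simp: pools_of_def occ_def mu_eq)
  also have "\<dots> = (\<Sum>j\<in>UNIV. m j * occ i j t)"
    by (rule sum_pools_of) (simp add: occ_def)
  finally have s: "(\<Sum>j\<in>pools_of E i. mu i j * psi i j t) = (\<Sum>j\<in>UNIV. m j * occ i j t)" .
  have "((\<lambda>t. x i 0 + lam i * t - (\<Sum>j\<in>pools_of E i. integral {0..t} (\<lambda>s. mu i j * psi i j s)))
      has_real_derivative (0 + lam i - (\<Sum>j\<in>pools_of E i. mu i j * psi i j t))) (at t)"
    by (intro DERIV_diff DERIV_add DERIV_const DERIV_cmult_Id DERIV_sum int)
  then have "((\<lambda>t. x i 0 + lam i * t - (\<Sum>j\<in>pools_of E i. integral {0..t} (\<lambda>s. mu i j * psi i j s)))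
      has_real_derivative (lam i - (\<Sum>j\<in>UNIV. m j * occ i j t))) (at t)"
    by (simp add: s)
  then show ?thesis
  proof (rule has_field_derivative_transform_within_open[of _ _ _ "{0<..}"])
    fix s :: real assume "s \<in> {0<..}"
    then show "x i 0 + lam i * s - (\<Sum>j\<in>pools_of E i. integral {0..s} (\<lambda>s. mu i j * psi i j s)) = x i s"
      by (intro x_eq_integral[symmetric]) auto
  qed (use t in auto)
qed

lemma negligible_irregular: "negligible {t. 0 < t \<and> \<not> regular_point E psi t}"
proof (rule negligible_subset)
  show "negligible (\<Union>(i, j)\<in>E. {t. 0 < t \<and> \<not> psi i j differentiable at t})"
  proof (intro negligible_Union)
    fix T assume "T \<in> (\<lambda>(i, j). {t. 0 < t \<and> \<not> psi i j differentiable at t}) ` E"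
    then obtain i j where "(i, j) \<in> E" "T = {t. 0 < t \<and> \<not> psi i j differentiable at t}"
      by auto
    then show "negligible T"
      using lip_psi negligible_nondifferentiable_lipschitz by blast
  qed auto
  show "{t. 0 < t \<and> \<not> regular_point E psi t} \<subseteq> (\<Union>(i, j)\<in>E. {t. 0 < t \<and> \<not> psi i j differentiable at t})"
    by (auto simp: regular_point_def)
qed

context
  fixes t assumes reg: "regular_point E psi t"
begin

lemma t_pos: "0 < t"
  using reg by (simp add: regular_point_def)

lemma occ_deriv: "(occ i j has_real_derivative docc i j t) (at t)"
proof (cases "(i, j) \<in> E")
  case True
  then have "psi i j differentiable at t"
    using reg by (auto simp: regular_point_def)
  then have "(psi i j has_real_derivative deriv (psi i j) t) (at t)"
    by (metis real_differentiable_def DERIV_imp_deriv)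
  with True show ?thesis
    by (simp add: occ_def[abs_def] docc_def)
qed (simp add: occ_def[abs_def] docc_def)

lemma q_deriv: "(q i has_real_derivative dq i t) (at t)"
proof -
  have "((\<lambda>t. x i t - (\<Sum>j\<in>UNIV. occ i j t)) has_real_derivative dq i t) (at t)"
    unfolding dq_def using t_pos by (intro derivative_intros x_deriv occ_deriv)
  then show ?thesis
    by (rule has_field_derivative_transform_within_open[of _ _ _ "{0<..}"]) (use t_pos in \<open>auto simp: occ_row\<close>)
qed

lemma load_deriv: "(load j has_real_derivative (\<Sum>i\<in>UNIV. docc i j t) / bet j) (at t)"
proof -
  have "((\<lambda>t. (\<Sum>i\<in>UNIV. occ i j t) / bet j) has_real_derivative (\<Sum>i\<in>UNIV. docc i j t) / bet j) (at t)"
    by (intro DERIV_cdivide DERIV_sum occ_deriv)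
  then show ?thesis
    by (rule has_field_derivative_transform_within_open[of _ _ _ "{0<..}"])
      (use t_pos bet_pos in \<open>auto simp: occ_col less_imp_neq[symmetric]\<close>)
qed

text \<open>The rule is used with all pools. Pools adjacent to \<open>Is\<close> are full, and since
  rates depend on the pool only, each completes work at rate \<open>bet j * m j\<close> whatever
  types it holds. The departures of the types in \<open>Is\<close> cancel from
  \<open>dq\<close>.\<close>

lemma busy_sum:
  assumes pos: "\<And>i. i \<in> Is \<Longrightarrow> 0 < q i t" and gt: "\<And>i i'. i \<in> Is \<Longrightarrow> i' \<notin> Is \<Longrightarrow> q i' t < q i t"
  shows "(\<Sum>i\<in>Is. dq i t) = (\<Sum>i\<in>Is. lam i) - (\<Sum>j\<in>(\<Union>i\<in>Is. pools_of E i). bet j * m j)"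
proof -
  have rule: "busy_pools_rule E mu q psi t"
    using fluid reg by (simp add: fluid_model_def)
  have "(\<Sum>i\<in>Is. \<Sum>j\<in>pools_of E i \<inter> UNIV. deriv (psi i j) t) =
      (\<Sum>j\<in>(\<Union>i\<in>Is. pools_of E i \<inter> UNIV). \<Sum>i'\<in>types_of E j. mu i' j * psi i' j t)
      - (\<Sum>i\<in>Is. \<Sum>j\<in>pools_of E i \<inter> UNIV. mu i j * psi i j t)"
    by (rule rule[unfolded busy_pools_rule_def, THEN spec, THEN spec, THEN mp]) (simp add: pos gt)
  moreover have "(\<Sum>j\<in>pools_of E i. deriv (psi i j) t) = (\<Sum>j\<in>UNIV. docc i j t)" for i
    by (subst sum_pools_of[of i E "\<lambda>i j. docc i j t", symmetric])
      (auto simp: docc_def pools_of_def intro!: sum.cong)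
  moreover have "(\<Sum>j\<in>pools_of E i. mu i j * psi i j t) = (\<Sum>j\<in>UNIV. m j * occ i j t)" for i
    by (subst sum_pools_of[of i E "\<lambda>i j. m j * occ i j t", symmetric])
      (auto simp: occ_def mu_eq pools_of_def intro!: sum.cong)
  moreover have "(\<Sum>i'\<in>types_of E j. mu i' j * psi i' j t) = bet j * m j" if j: "j \<in> (\<Union>i\<in>Is. pools_of E i)" for j
  proof -
    have "load j t = 1"
      using j pos load_eq_1 t_pos by (force simp: pools_of_def)
    moreover have "(\<Sum>i'\<in>types_of E j. mu i' j * psi i' j t) = (\<Sum>i\<in>UNIV. m j * occ i j t)"
      by (subst sum_types_of[of j E "\<lambda>i j. m j * occ i j t", symmetric])
        (auto simp: occ_def mu_eq types_of_def intro!: sum.cong)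
    ultimately show ?thesis
      using occ_col[of t j] t_pos by (simp add: sum_distrib_left[symmetric])
  qed
  ultimately show ?thesis
    by (simp add: dq_def sum_subtractf)
qed

text \<open>The rule is used with all types. Departures from a pool depend on its load alone, so the
  drift of a set of least loaded pools is independent of their mix of types.\<close>

lemma idle_sum:
  assumes lt1: "\<And>j. j \<in> Js \<Longrightarrow> load j t < 1" and lt: "\<And>j j'. j \<in> Js \<Longrightarrow> j' \<notin> Js \<Longrightarrow> load j t < load j' t"
  shows "(\<Sum>j\<in>Js. \<Sum>i\<in>UNIV. docc i j t) =
    (\<Sum>i\<in>(\<Union>j\<in>Js. types_of E j). lam i) - (\<Sum>j\<in>Js. bet j * m j * load j t)"
proof -
  have rule: "idle_pools_rule E lam mu psi load t"
    using fluid reg by (simp add: fluid_model_def)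
  have "(\<Sum>j\<in>Js. \<Sum>i\<in>types_of E j \<inter> UNIV. deriv (psi i j) t) =
          (\<Sum>i\<in>(\<Union>j\<in>Js. types_of E j \<inter> UNIV). lam i)
          - (\<Sum>j\<in>Js. \<Sum>i\<in>types_of E j \<inter> UNIV. mu i j * psi i j t)"
    by (rule rule[unfolded idle_pools_rule_def, THEN spec, THEN spec, THEN mp]) (simp add: lt1 lt)
  moreover have "(\<Sum>i\<in>types_of E j. deriv (psi i j) t) = (\<Sum>i\<in>UNIV. docc i j t)" for j
    by (subst sum_types_of[of j E "\<lambda>i j. docc i j t", symmetric])
      (auto simp: docc_def types_of_def intro!: sum.cong)
  moreover have "(\<Sum>i\<in>types_of E j. mu i j * psi i j t) = bet j * m j * load j t" for j
  proof -
    have "(\<Sum>i\<in>types_of E j. mu i j * psi i j t) = (\<Sum>i\<in>UNIV. m j * occ i j t)"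
      by (subst sum_types_of[of j E "\<lambda>i j. m j * occ i j t", symmetric])
        (auto simp: occ_def mu_eq types_of_def intro!: sum.cong)
    then show ?thesis
      using occ_col[of t j] t_pos by (simp add: sum_distrib_left[symmetric])
  qed
  ultimately show ?thesis
    by simp
qed

end

lemma sum_dq: "0 \<le> t \<Longrightarrow> (\<Sum>i\<in>UNIV. dq i t) =
    (\<Sum>i\<in>UNIV. lam i) - (\<Sum>j\<in>UNIV. bet j * m j * load j t) - (\<Sum>j\<in>UNIV. \<Sum>i\<in>UNIV. docc i j t)"
proof -
  assume t: "0 \<le> t"
  have "(\<Sum>i\<in>UNIV. \<Sum>j\<in>UNIV. m j * occ i j t) = (\<Sum>j\<in>UNIV. bet j * m j * load j t)"
    by (subst sum.swap) (simp add: sum_distrib_left[symmetric] occ_col[OF t] mult_ac)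
  moreover have "(\<Sum>i\<in>UNIV. \<Sum>j\<in>UNIV. docc i j t) = (\<Sum>j\<in>UNIV. \<Sum>i\<in>UNIV. docc i j t)"
    by (rule sum.swap)
  ultimately show ?thesis
    by (simp add: dq_def sum_subtractf)
qed

end

section \<open>Drift of the queues and of the loads\<close>

context network_fluid_model
begin

lemma capacity_min: obtains b where "0 < b" "\<And>j. b \<le> bet j * m j"
proof
  show "0 < Min (range (\<lambda>j. bet j * m j))"
    by (subst Min_gr_iff) (auto simp: bm_pos)
  show "Min (range (\<lambda>j. bet j * m j)) \<le> bet j * m j" for j
    by (intro Min_le) auto
qed

lemma rate_min: obtains b where "0 < b" "\<And>j. b \<le> m j"
proof
  show "0 < Min (range m)"
    by (subst Min_gr_iff) (auto simp: m_pos)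
  show "Min (range m) \<le> m j" for j
    by (intro Min_le) auto
qed

abbreviation "Q t \<equiv> Max (range (\<lambda>i. q i t))"

lemma q_le_Q: "q i t \<le> Q t"
  by (intro Max_ge) auto

lemma Q_attained: obtains i where "q i t = Q t"
  by (rule Max_range_attained[of "\<lambda>i. q i t"])

lemma Q_nonneg: "0 \<le> t \<Longrightarrow> 0 \<le> Q t"
  using Q_attained[of t] q_nonneg by metis

lemma Q_drift:
  obtains N where "negligible N"
    and "\<And>t. 0 < t \<Longrightarrow> t \<notin> N \<Longrightarrow> \<exists>D. (Q has_real_derivative D) (at t) \<and> (Q t = 0 \<longrightarrow> D = 0) \<and>
      (0 < Q t \<longrightarrow> real (card {i. q i t = Q t}) * D =
        (\<Sum>i\<in>{i. q i t = Q t}. lam i) - (\<Sum>j\<in>(\<Union>i\<in>{i. q i t = Q t}. pools_of E i). bet j * m j))"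
proof -
  obtain M where M: "negligible M"
    "\<And>t. 0 < t \<Longrightarrow> t \<notin> M \<Longrightarrow> \<exists>D. (Q has_real_derivative D) (at t) \<and>
       (\<forall>i d. q i t = Q t \<longrightarrow> (q i has_real_derivative d) (at t) \<longrightarrow> d = D)"
    using ae_derivative_Max[of 0 q] lip_q by blast
  show thesis
  proof (rule that)
    show "negligible (M \<union> {t. 0 < t \<and> \<not> regular_point E psi t})"
      using M(1) negligible_irregular by (rule negligible_Un)
    fix t assume t: "0 < t" "t \<notin> M \<union> {t. 0 < t \<and> \<not> regular_point E psi t}"
    then have reg: "regular_point E psi t" by auto
    obtain D where D: "(Q has_real_derivative D) (at t)"
      "\<And>i d. q i t = Q t \<Longrightarrow> (q i has_real_derivative d) (at t) \<Longrightarrow> d = D"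
      using M(2)[of t] t by auto
    let ?I = "{i. q i t = Q t}"
    \<comment> \<open>Where the nonnegative \<open>Q\<close> vanishes it touches the constant 0 from
      above.\<close>
    have "D = 0" if "Q t = 0"
      by (rule has_real_derivative_eq_of_touching[OF D(1) DERIV_const[of 0] t(1)])
        (use that Q_nonneg in auto)
    moreover have "real (card ?I) * D = (\<Sum>i\<in>?I. lam i) - (\<Sum>j\<in>(\<Union>i\<in>?I. pools_of E i). bet j * m j)"
      if "0 < Q t"
    proof -
      have "q i' t < q i t" if "i \<in> ?I" "i' \<notin> ?I" for i i'
        using that q_le_Q[of i' t] by (simp add: less_le)
      then have "(\<Sum>i\<in>?I. dq i t) = (\<Sum>i\<in>?I. lam i) - (\<Sum>j\<in>(\<Union>i\<in>?I. pools_of E i). bet j * m j)"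
        using that by (intro busy_sum[OF reg]) auto
      moreover have "(\<Sum>i\<in>?I. dq i t) = (\<Sum>i\<in>?I. D)"
        using D(2)[OF _ q_deriv[OF reg]] by (intro sum.cong) auto
      ultimately show ?thesis by simp
    qed
    ultimately show "\<exists>D. (Q has_real_derivative D) (at t) \<and> (Q t = 0 \<longrightarrow> D = 0) \<and>
      (0 < Q t \<longrightarrow> real (card ?I) * D =
        (\<Sum>i\<in>?I. lam i) - (\<Sum>j\<in>(\<Union>i\<in>?I. pools_of E i). bet j * m j))"
      using D(1) by blast
  qed
qed

lemma card_argmax: "0 < real (card {i. q i t = Q t})" "real (card {i. q i t = Q t}) \<le> real CARD('i)"
proof -
  obtain i where "q i t = Q t" using Q_attained .
  then have "{i. q i t = Q t} \<noteq> {}" by blast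
  then show "0 < real (card {i. q i t = Q t})" by (simp add: card_gt_0_iff)
  show "real (card {i. q i t = Q t}) \<le> real CARD('i)" by (simp add: card_mono)
qed

text \<open>While \<open>Q\<close> is positive, the summed drift of the largest queues is at most
  \<open>-(1 - rho)\<close> times the capacity of their pools, and there is at least one such pool.
  The queues are thus empty after a finite time, as \<open>loads_eventually_le\<close>
  requires.\<close>

lemma queues_vanish:
  assumes "rho < 1"
  obtains s where "0 \<le> s" "\<And>t i. s \<le> t \<Longrightarrow> q i t = 0"
proof -
  obtain b where b: "0 < b" "\<And>j. b \<le> bet j * m j" using capacity_min by blast
  obtain N where N: "negligible N"
    "\<And>t. 0 < t \<Longrightarrow> t \<notin> N \<Longrightarrow> \<exists>D. (Q has_real_derivative D) (at t) \<and> (Q t = 0 \<longrightarrow> D = 0) \<and>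
      (0 < Q t \<longrightarrow> real (card {i. q i t = Q t}) * D =
        (\<Sum>i\<in>{i. q i t = Q t}. lam i) - (\<Sum>j\<in>(\<Union>i\<in>{i. q i t = Q t}. pools_of E i). bet j * m j))"
    using Q_drift by blast
  obtain L where L: "L-lipschitz_on {0..} Q"
    using lipschitz_on_Max[of "{0..}" q] lip_q by blast
  define e where "e = (1 - rho) * b"
  have e: "0 < e" using assms b by (simp add: e_def)
  obtain s where s: "0 \<le> s" "\<And>t. s \<le> t \<Longrightarrow> Q t \<le> 0"
  proof (rule eventually_le_of_ae_decrease[OF L N(1)])
    show "0 < e / real CARD('i)" using e by simp
    fix t assume t: "0 < t" "t \<notin> N" "0 < Q t"
    let ?I = "{i. q i t = Q t}"
    let ?P = "\<Union>i\<in>?I. pools_of E i"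
    obtain D where D: "(Q has_real_derivative D) (at t)"
      "real (card ?I) * D = (\<Sum>i\<in>?I. lam i) - (\<Sum>j\<in>?P. bet j * m j)"
      using N(2) t by blast
    obtain i j where "i \<in> ?I" "j \<in> pools_of E i"
      using Q_attained[of t] pools_of_nonempty by blast
    then have j: "j \<in> ?P" by blast
    have "real (card ?I) * D \<le> - ((1 - rho) * (\<Sum>j\<in>?P. bet j * m j))"
      unfolding D(2) using lam_le_capacity[of ?I] by (simp add: left_diff_distrib)
    also have "\<dots> \<le> - e"
    proof -
      have "b \<le> (\<Sum>j\<in>?P. bet j * m j)"
        using b(2)[of j] member_le_sum[OF j, of "\<lambda>j. bet j * m j"] less_imp_le[OF bm_pos] by force
      then show ?thesis
        using assms by (simp add: e_def)
    qed
    finally have "D \<le> - (e / real CARD('i))"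
      using e by (intro le_neg_divide_of_mult_le[OF _ card_argmax]) auto
    with D(1) show "\<exists>D\<le>- (e / real CARD('i)). (Q has_real_derivative D) (at t)" by blast
  qed blast
  show thesis
  proof (rule that[OF s(1)])
    fix t i assume "s \<le> t"
    then show "q i t = 0"
      using s(1) s(2)[of t] q_le_Q[of i t] q_nonneg[of t i] by linarith
  qed
qed

text \<open>At \<open>rho = 1\<close> the total arrival rate equals the full capacity while no load
  exceeds 1, so the total of \<open>x\<close> never decreases. The negated form fits
  \<open>antimono_tendsto_at_top\<close>.\<close>

lemma sum_x_antimono:
  assumes "rho = 1" "0 \<le> s" "s \<le> t"
  shows "- (\<Sum>i\<in>UNIV. x i t) \<le> - (\<Sum>i\<in>UNIV. x i s)"
proof -
  have "\<exists>L. L-lipschitz_on {0..} (\<lambda>t. \<Sum>i\<in>UNIV. x i t)"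
    by (intro lipschitz_on_sum_ex lip_x)
  then obtain L where L: "L-lipschitz_on {0..} (\<lambda>t. - (\<Sum>i\<in>UNIV. x i t))"
    by (auto simp: lipschitz_on_minus_iff)
  show ?thesis
  proof (rule antimono_of_ae_derivative_nonpos[OF assms(3) lipschitz_on_subset[OF L] negligible_empty])
    show "{s..t} \<subseteq> {0..}" using assms by auto
    fix u assume "s < u" "u < t"
    then have u: "0 < u" using assms by simp
    have "((\<lambda>t. - (\<Sum>i\<in>UNIV. x i t)) has_real_derivative
        - (\<Sum>i\<in>UNIV. lam i - (\<Sum>j\<in>UNIV. m j * occ i j u))) (at u)"
      by (intro DERIV_minus DERIV_sum x_deriv u)
    moreover have eq: "(\<Sum>i\<in>UNIV. lam i - (\<Sum>j\<in>UNIV. m j * occ i j u)) =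
        (\<Sum>j\<in>UNIV. bet j * m j * (1 - load j u))"
    proof -
      have "(\<Sum>i\<in>UNIV. \<Sum>j\<in>UNIV. m j * occ i j u) = (\<Sum>j\<in>UNIV. bet j * m j * load j u)"
        using u by (subst sum.swap) (simp add: sum_distrib_left[symmetric] occ_col mult_ac)
      then show ?thesis
        using sum_lam assms(1) by (simp add: sum_subtractf right_diff_distrib)
    qed
    moreover have "0 \<le> (\<Sum>j\<in>UNIV. bet j * m j * (1 - load j u))"
      using u load_le_1 by (intro sum_nonneg mult_nonneg_nonneg less_imp_le[OF bm_pos]) auto
    ultimately show "\<exists>D\<le>0. ((\<lambda>t. - (\<Sum>i\<in>UNIV. x i t)) has_real_derivative D) (at u)"
      unfolding eq by (intro exI[of _ "- (\<Sum>j\<in>UNIV. bet j * m j * (1 - load j u))"] conjI) simp_all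
  qed
qed

text \<open>\<open>U\<close> will be the distance of the extremal loads from \<open>rho\<close>. As
  all rates are at least \<open>b\<close>, the resulting bound is uniform in the set
  \<open>Js\<close>.\<close>

lemma weighted_rate_bound:
  fixes D U b :: real
  assumes "\<And>j. b \<le> m j" "Js \<noteq> {}" "0 \<le> U"
    and "D * (\<Sum>j\<in>Js. bet j) \<le> - (U * (\<Sum>j\<in>Js. bet j * m j))"
  shows "D \<le> - (b * U)"
proof -
  have pos: "0 < (\<Sum>j\<in>Js. bet j)"
    using assms(2) by (intro sum_pos) (auto simp: bet_pos)
  have "b * (\<Sum>j\<in>Js. bet j) \<le> (\<Sum>j\<in>Js. bet j * m j)"
    unfolding sum_distrib_left by (intro sum_mono) (use assms(1) bet_pos in \<open>simp add: mult.commute\<close>)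
  then have "U * (b * (\<Sum>j\<in>Js. bet j)) \<le> U * (\<Sum>j\<in>Js. bet j * m j)"
    using assms(3) by (rule mult_left_mono)
  with assms(4) have "D * (\<Sum>j\<in>Js. bet j) \<le> - (b * U) * (\<Sum>j\<in>Js. bet j)"
    by (simp add: mult_ac)
  then show ?thesis
    using pos by (simp only: mult_le_cancel_right_pos)
qed

text \<open>The least loaded pools receive all arrivals of their types, at least \<open>rho\<close>
  times their capacity, and complete only \<open>rho - ?U t\<close> times it. Their shortfall
  \<open>?U t\<close> therefore shrinks at least at the rate \<open>b * ?U t\<close>.\<close>

lemma loads_eventually_ge:
  assumes rho: "rho \<le> 1" and d: "0 < d"
  shows "\<forall>\<^sub>F t in at_top. \<forall>j. rho - load j t \<le> d"
proof -
  let ?f = "\<lambda>j t. rho - load j t"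
  let ?U = "\<lambda>t. Max (range (\<lambda>j. ?f j t))"
  have lip: "\<exists>L. L-lipschitz_on {0..} (?f j)" for j
    using lipschitz_on_add_ex[OF lipschitz_on_const_ex[of _ rho] lipschitz_on_cmult_ex[OF lip_load[of j], of "-1"]] by simp
  obtain L where L: "L-lipschitz_on {0..} ?U"
    using lipschitz_on_Max[of "{0..}" ?f, OF lip] by blast
  obtain N where N: "negligible N"
    "\<And>t. 0 < t \<Longrightarrow> t \<notin> N \<Longrightarrow> \<exists>D. (?U has_real_derivative D) (at t) \<and>
       (\<forall>j d. ?f j t = ?U t \<longrightarrow> (?f j has_real_derivative d) (at t) \<longrightarrow> d = D)"
    using ae_derivative_Max[of 0 ?f, OF lip] by blast
  obtain b where b: "0 < b" "\<And>j. b \<le> m j" using rate_min by blast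
  obtain s where "\<And>t. s \<le> t \<Longrightarrow> ?U t \<le> d"
  proof (rule eventually_le_of_ae_decrease[OF L negligible_Un[OF N(1) negligible_irregular]])
    show "0 < b * d" using b d by simp
    fix t assume t: "0 < t" "t \<notin> N \<union> {t. 0 < t \<and> \<not> regular_point E psi t}" "d < ?U t"
    then have reg: "regular_point E psi t" by auto
    obtain D where D: "(?U has_real_derivative D) (at t)"
      "\<And>j d. ?f j t = ?U t \<Longrightarrow> (?f j has_real_derivative d) (at t) \<Longrightarrow> d = D"
      using N(2)[of t] t by auto
    let ?J = "{j. ?f j t = ?U t}"
    have ne: "?J \<noteq> {}"
      using Max_range_attained[of "\<lambda>j. ?f j t"] by blast
    have le: "?f j t \<le> ?U t" for j by (intro Max_ge) auto
    have "load j t < 1" if "j \<in> ?J" for j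
      using that t(3) d rho by auto
    moreover have "load j t < load j' t" if "j \<in> ?J" "j' \<notin> ?J" for j j'
      using that order.not_eq_order_implies_strict[OF _ le[of j']] by force
    ultimately have idle: "(\<Sum>j\<in>?J. \<Sum>i\<in>UNIV. docc i j t) =
        (\<Sum>i\<in>(\<Union>j\<in>?J. types_of E j). lam i) - (\<Sum>j\<in>?J. bet j * m j * load j t)"
      by (intro idle_sum[OF reg]) auto
    have dsum: "(\<Sum>i\<in>UNIV. docc i j t) = - D * bet j" if "j \<in> ?J" for j
    proof -
      have "(?f j has_real_derivative 0 - (\<Sum>i\<in>UNIV. docc i j t) / bet j) (at t)"
        by (intro DERIV_diff DERIV_const load_deriv reg)
      then have "0 - (\<Sum>i\<in>UNIV. docc i j t) / bet j = D"
        using D(2) that by blast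
      then show ?thesis using bet_pos[of j] by (auto simp: field_simps)
    qed
    have load: "(\<Sum>j\<in>?J. bet j * m j * load j t) = (rho - ?U t) * (\<Sum>j\<in>?J. bet j * m j)"
      unfolding sum_distrib_left
    proof (rule sum.cong)
      fix j assume "j \<in> ?J"
      then have "load j t = rho - ?U t" by auto
      then show "bet j * m j * load j t = (rho - ?U t) * (bet j * m j)"
        by (metis mult.commute)
    qed simp
    have "(\<Sum>j\<in>?J. \<Sum>i\<in>UNIV. docc i j t) = - D * (\<Sum>j\<in>?J. bet j)"
      unfolding sum_distrib_left by (intro sum.cong refl dsum)
    with idle load have "- D * (\<Sum>j\<in>?J. bet j) = (\<Sum>i\<in>(\<Union>j\<in>?J. types_of E j). lam i) - (rho - ?U t) * (\<Sum>j\<in>?J. bet j * m j)"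
      by (simp only:)
    then have "D * (\<Sum>j\<in>?J. bet j) \<le> - (?U t * (\<Sum>j\<in>?J. bet j * m j))"
      using capacity_le_lam[of ?J] by (simp add: left_diff_distrib)
    then have "D \<le> - (b * ?U t)"
      using b ne t(3) d by (intro weighted_rate_bound[of b ?J]) auto
    also have "\<dots> \<le> - (b * d)"
      using b t(3) by (simp add: mult_left_mono)
    finally show "\<exists>D\<le>- (b * d). (?U has_real_derivative D) (at t)"
      using D(1) by blast
  qed blast
  then have "rho - load j t \<le> d" if "s \<le> t" for t j
    using that Max_ge[of "range (\<lambda>j. ?f j t)" "?f j t"] by force
  then show ?thesis
    by (auto simp: eventually_at_top_linorder)
qed

text \<open>The idle rule covers sets of least loads only, so it is applied to the complement of the
  most loaded pools, whose loads are below the maximum and hence below 1. With the queues at zero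
  the drift of all pools together is known, and subtraction leaves the most loaded ones.\<close>

lemma loads_eventually_le:
  assumes rho: "rho < 1" and d: "0 < d"
  shows "\<forall>\<^sub>F t in at_top. \<forall>j. load j t - rho \<le> d"
proof -
  obtain s0 where s0: "0 \<le> s0" "\<And>t i. s0 \<le> t \<Longrightarrow> q i t = 0"
    using queues_vanish[OF rho] by blast
  let ?f = "\<lambda>j t. load j t - rho"
  let ?U = "\<lambda>t. Max (range (\<lambda>j. ?f j t))"
  have lip: "\<exists>L. L-lipschitz_on {0..} (?f j)" for j
    using lipschitz_on_add_ex[OF lip_load[of j] lipschitz_on_const_ex[of _ "- rho"]] by simp
  obtain L where L: "L-lipschitz_on {0..} ?U"
    using lipschitz_on_Max[of "{0..}" ?f, OF lip] by blast
  obtain N where N: "negligible N"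
    "\<And>t. 0 < t \<Longrightarrow> t \<notin> N \<Longrightarrow> \<exists>D. (?U has_real_derivative D) (at t) \<and>
       (\<forall>j d. ?f j t = ?U t \<longrightarrow> (?f j has_real_derivative d) (at t) \<longrightarrow> d = D)"
    using ae_derivative_Max[of 0 ?f, OF lip] by blast
  obtain b where b: "0 < b" "\<And>j. b \<le> m j" using rate_min by blast
  obtain s where "\<And>t. s \<le> t \<Longrightarrow> ?U t \<le> d"
  proof (rule eventually_le_of_ae_decrease[OF lipschitz_on_subset[OF L] negligible_Un[OF N(1) negligible_irregular]])
    show "{s0..} \<subseteq> {0..}" using s0 by auto
    show "0 < b * d" using b d by simp
    fix t assume t: "s0 < t" "t \<notin> N \<union> {t. 0 < t \<and> \<not> regular_point E psi t}" "d < ?U t"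
    then have t0: "0 < t" and reg: "regular_point E psi t" using s0 by auto
    obtain D where D: "(?U has_real_derivative D) (at t)"
      "\<And>j d. ?f j t = ?U t \<Longrightarrow> (?f j has_real_derivative d) (at t) \<Longrightarrow> d = D"
      using N(2)[of t] t t0 by auto
    let ?J = "{j. ?f j t = ?U t}"
    obtain j0 where j0: "?f j0 t = ?U t"
      by (rule Max_range_attained[of "\<lambda>j. ?f j t"])
    have le: "?f j t \<le> ?U t" for j by (intro Max_ge) auto
    have lt: "load j t < load j' t" if "j \<in> - ?J" "j' \<notin> - ?J" for j j'
      using that order.not_eq_order_implies_strict[OF _ le[of j]] by force
    have "load j t < 1" if "j \<in> - ?J" for j
      using lt[OF that, of j0] j0 load_le_1[of t j0] t0 by auto
    then have idle: "(\<Sum>j\<in>-?J. \<Sum>i\<in>UNIV. docc i j t) =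
        (\<Sum>i\<in>(\<Union>j\<in>-?J. types_of E j). lam i) - (\<Sum>j\<in>-?J. bet j * m j * load j t)"
      using lt by (intro idle_sum[OF reg]) auto
    have "dq i t = 0" for i
    proof -
      have "((\<lambda>t. 0) has_real_derivative dq i t) (at t)"
        using q_deriv[OF reg] by (rule has_field_derivative_transform_within_open[of _ _ _ "{s0<..}"]) (use t s0 in auto)
      then show ?thesis
        using DERIV_unique DERIV_const by blast
    qed
    then have total: "(\<Sum>j\<in>UNIV. \<Sum>i\<in>UNIV. docc i j t) = (\<Sum>i\<in>UNIV. lam i) - (\<Sum>j\<in>UNIV. bet j * m j * load j t)"
      using sum_dq[of t] t0 by simp
    have split: "(\<Sum>j\<in>UNIV. g j) = (\<Sum>j\<in>?J. g j) + (\<Sum>j\<in>-?J. g j)" for g :: "'j \<Rightarrow> real"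
      using sum.union_disjoint[of ?J "- ?J" g] by (simp add: Compl_partition)
    have "(\<Sum>j\<in>?J. \<Sum>i\<in>UNIV. docc i j t) =
        (\<Sum>i\<in>UNIV. lam i) - (\<Sum>i\<in>(\<Union>j\<in>-?J. types_of E j). lam i) - (\<Sum>j\<in>?J. bet j * m j * load j t)"
      using total idle unfolding split by linarith
    moreover have "(\<Sum>i\<in>UNIV. lam i) - (\<Sum>i\<in>(\<Union>j\<in>-?J. types_of E j). lam i) \<le> rho * (\<Sum>j\<in>?J. bet j * m j)"
      using capacity_le_lam[of "- ?J"] unfolding sum_lam split by (simp add: distrib_left)
    moreover have "(\<Sum>j\<in>?J. \<Sum>i\<in>UNIV. docc i j t) = D * (\<Sum>j\<in>?J. bet j)"
    proof -
      have "(\<Sum>i\<in>UNIV. docc i j t) = D * bet j" if "j \<in> ?J" for j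
      proof -
        have "(?f j has_real_derivative (\<Sum>i\<in>UNIV. docc i j t) / bet j - 0) (at t)"
          by (intro DERIV_diff DERIV_const load_deriv reg)
        then have "(\<Sum>i\<in>UNIV. docc i j t) / bet j - 0 = D"
          using D(2) that by blast
        then show ?thesis using bet_pos[of j] by (auto simp: field_simps)
      qed
      then show ?thesis by (simp add: sum_distrib_left)
    qed
    moreover have "(\<Sum>j\<in>?J. bet j * m j * load j t) = (rho + ?U t) * (\<Sum>j\<in>?J. bet j * m j)"
      unfolding sum_distrib_left
    proof (rule sum.cong)
      fix j assume "j \<in> ?J"
      then have "load j t = rho + ?U t" by auto
      then show "bet j * m j * load j t = (rho + ?U t) * (bet j * m j)"
        by (metis mult.commute)
    qed simp
    ultimately have "D * (\<Sum>j\<in>?J. bet j) \<le> - (?U t * (\<Sum>j\<in>?J. bet j * m j))"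
      by (simp add: distrib_right)
    then have "D \<le> - (b * ?U t)"
      using b j0 t(3) d by (intro weighted_rate_bound[of b ?J]) auto
    also have "\<dots> \<le> - (b * d)"
      using b t(3) by (simp add: mult_left_mono)
    finally show "\<exists>D\<le>- (b * d). (?U has_real_derivative D) (at t)"
      using D(1) by blast
  qed blast
  then have "load j t - rho \<le> d" if "s \<le> t" for t j
    using that Max_ge[of "range (\<lambda>j. ?f j t)" "?f j t"] by force
  then show ?thesis
    by (auto simp: eventually_at_top_linorder)
qed

lemma load_tendsto:
  assumes rho: "rho \<le> 1"
  shows "(load j \<longlongrightarrow> rho) at_top"
proof (rule tendstoI)
  fix e :: real assume "0 < e"
  then have e: "0 < e / 2" by simp
  have "\<forall>\<^sub>F t in at_top. load j t - rho \<le> e / 2"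
  proof (cases "rho < 1")
    case True
    from loads_eventually_le[OF this e] show ?thesis by (rule eventually_mono) blast
  next
    case False
    have "load j t - rho \<le> e / 2" if "0 \<le> t" for t
      using load_le_1[OF that, of j] False e by linarith
    then show ?thesis
      by (auto simp: eventually_at_top_linorder)
  qed
  moreover have "\<forall>\<^sub>F t in at_top. rho - load j t \<le> e / 2"
    using loads_eventually_ge[OF rho e] by (rule eventually_mono) blast
  ultimately show "\<forall>\<^sub>F t in at_top. dist (load j t) rho < e"
  proof eventually_elim
    case (elim t)
    with e show ?case unfolding dist_real_def by linarith
  qed
qed

end

section \<open>Convergence to equilibrium\<close>

context network_fluid_model
begin

text \<open>The spread \<open>?D\<close> compares the total queue with the case of all queues equal
  to \<open>Q\<close>. It converges, since \<open>Q\<close> and the total of \<open>x\<close> are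
  monotone and bounded and the loads converge. A positive limit would keep the set of largest queues
  proper from some time on, and \<open>lam_gap\<close> would drive \<open>Q\<close> below
  zero.\<close>

lemma critical_queues_tendsto:
  assumes rho: "rho = 1"
  obtains c where "0 \<le> c" "\<And>i. (q i \<longlongrightarrow> c) at_top"
proof -
  let ?n = "real CARD('i)"
  obtain d where d: "0 < d" "\<And>i j. (i, j) \<in> E \<Longrightarrow> d \<le> l i j" using l_min by blast
  obtain N where N: "negligible N"
    "\<And>t. 0 < t \<Longrightarrow> t \<notin> N \<Longrightarrow> \<exists>D. (Q has_real_derivative D) (at t) \<and> (Q t = 0 \<longrightarrow> D = 0) \<and>
      (0 < Q t \<longrightarrow> real (card {i. q i t = Q t}) * D =
        (\<Sum>i\<in>{i. q i t = Q t}. lam i) - (\<Sum>j\<in>(\<Union>i\<in>{i. q i t = Q t}. pools_of E i). bet j * m j))"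
    using Q_drift by blast
  obtain L where L: "L-lipschitz_on {0..} Q"
    using lipschitz_on_Max[of "{0..}" q] lip_q by blast
  have Q_anti: "Q t \<le> Q s" if st: "0 \<le> s" "s \<le> t" for s t
  proof (rule antimono_of_ae_derivative_nonpos[OF st(2) lipschitz_on_subset[OF L] N(1)])
    show "{s..t} \<subseteq> {0..}" using st by auto
    fix u assume u: "s < u" "u < t" "u \<notin> N"
    let ?I = "{i. q i u = Q u}"
    from u st have "0 < u" by simp
    then obtain D where D: "(Q has_real_derivative D) (at u)" "Q u = 0 \<longrightarrow> D = 0"
      "0 < Q u \<longrightarrow> real (card ?I) * D = (\<Sum>i\<in>?I. lam i) - (\<Sum>j\<in>(\<Union>i\<in>?I. pools_of E i). bet j * m j)"
      using N(2) u(3) by blast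
    have "D \<le> 0"
    proof (cases "Q u = 0")
      case False
      then have "0 < Q u" using Q_nonneg[of u] \<open>0 < u\<close> by linarith
      then have "real (card ?I) * D \<le> 0"
        using D(3) lam_le_capacity[of ?I] rho by simp
      then show ?thesis
        using card_argmax(1)[of u] by (simp only: mult_le_0_iff) linarith
    qed (use D in simp)
    with D(1) show "\<exists>D\<le>0. (Q has_real_derivative D) (at u)" by blast
  qed
  obtain c where c: "0 \<le> c" "(Q \<longlongrightarrow> c) at_top"
    using antimono_tendsto_at_top[of 0 Q 0] Q_anti Q_nonneg by blast
  have sumx: "(\<Sum>i\<in>UNIV. x i t) = (\<Sum>i\<in>UNIV. q i t) + (\<Sum>j\<in>UNIV. bet j * load j t)" if "0 \<le> t" for t
  proof -
    have "(\<Sum>i\<in>UNIV. x i t - q i t) = (\<Sum>j\<in>UNIV. bet j * load j t)"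
      unfolding occ_row[OF that, symmetric] occ_col[OF that, symmetric] by (rule sum.swap)
    then show ?thesis by (simp add: sum_subtractf)
  qed
  have qsum_le: "(\<Sum>i\<in>UNIV. q i t) \<le> ?n * Q t" for t
    using sum_bounded_above[of UNIV "\<lambda>i. q i t" "Q t"] q_le_Q by simp
  have lower: "- (?n * Q 0 + (\<Sum>j\<in>UNIV. bet j)) \<le> - (\<Sum>i\<in>UNIV. x i t)" if t: "0 \<le> t" for t
  proof -
    have "(\<Sum>j\<in>UNIV. bet j * load j t) \<le> (\<Sum>j\<in>UNIV. bet j)"
      using load_le_1[OF t] bet_pos by (intro sum_mono) (simp add: mult_left_le less_imp_le)
    moreover have "?n * Q t \<le> ?n * Q 0"
      using Q_anti[OF order_refl t] by (rule mult_left_mono) simp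
    ultimately show ?thesis
      using qsum_le[of t] sumx[OF t] by linarith
  qed
  obtain X where X: "((\<lambda>t. - (\<Sum>i\<in>UNIV. x i t)) \<longlongrightarrow> X) at_top"
    using antimono_tendsto_at_top[of 0 "\<lambda>t. - (\<Sum>i\<in>UNIV. x i t)", OF sum_x_antimono[OF rho] lower] by metis
  let ?D = "\<lambda>t. ?n * Q t - (\<Sum>i\<in>UNIV. q i t)"
  define D' where "D' = ?n * c + X + (\<Sum>j\<in>UNIV. bet j * rho)"
  have "((\<lambda>t. ?n * Q t + (- (\<Sum>i\<in>UNIV. x i t)) + (\<Sum>j\<in>UNIV. bet j * load j t)) \<longlongrightarrow> D') at_top"
    unfolding D'_def using rho by (intro tendsto_intros c(2) X load_tendsto) auto
  moreover have "\<forall>\<^sub>F t in at_top. ?n * Q t + (- (\<Sum>i\<in>UNIV. x i t)) + (\<Sum>j\<in>UNIV. bet j * load j t) = ?D t"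
    using eventually_ge_at_top[of 0] by eventually_elim (simp add: sumx)
  ultimately have D': "(?D \<longlongrightarrow> D') at_top"
    by (rule Lim_transform_eventually)
  have "D' \<le> 0"
  proof (rule ccontr)
    assume "\<not> D' \<le> 0"
    then have "\<forall>\<^sub>F t in at_top. 0 < ?D t"
      using order_tendstoD(1)[OF D', of 0] by simp
    then obtain T where T: "\<And>t. T \<le> t \<Longrightarrow> 0 < ?D t"
      by (auto simp: eventually_at_top_linorder)
    \<comment> \<open>\<open>Q\<close> is never negative at positive times, so reaching the level
      \<open>-1\<close> is the contradiction sought.\<close>
    obtain s where s: "max 0 T \<le> s" "\<And>t. s \<le> t \<Longrightarrow> Q t \<le> - 1"
    proof (rule eventually_le_of_ae_decrease[OF lipschitz_on_subset[OF L] N(1)])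
      show "{max 0 T..} \<subseteq> {0..}" by auto
      show "0 < d / ?n" using d by simp
      fix t assume t: "max 0 T < t" "t \<notin> N"
      then have t0: "0 < t" and gap: "0 < ?D t" using T[of t] by auto
      let ?I = "{i. q i t = Q t}"
      obtain D where D: "(Q has_real_derivative D) (at t)"
        "0 < Q t \<longrightarrow> real (card ?I) * D = (\<Sum>i\<in>?I. lam i) - (\<Sum>j\<in>(\<Union>i\<in>?I. pools_of E i). bet j * m j)"
        using N(2)[OF t0 t(2)] by blast
      have "0 \<le> (\<Sum>i\<in>UNIV. q i t)"
        using t0 by (intro sum_nonneg) (simp add: q_nonneg)
      with gap have "0 < ?n * Q t" by linarith
      then have "0 < Q t" by (simp only: zero_less_mult_iff) linarith
      have "?I \<noteq> UNIV"
      proof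
        assume "?I = UNIV"
        then have "q i t = Q t" for i by blast
        then have "(\<Sum>i\<in>UNIV. q i t) = (\<Sum>i::'i\<in>UNIV. Q t)" by (intro sum.cong refl)
        then show False using gap by simp
      qed
      moreover have "?I \<noteq> {}"
        using Q_attained[of t] by blast
      ultimately have "(\<Sum>i\<in>?I. lam i) + d \<le> rho * (\<Sum>j\<in>(\<Union>i\<in>?I. pools_of E i). bet j * m j)"
        using d(2) by (intro lam_gap) auto
      then have "real (card ?I) * D \<le> - d"
        using D(2) \<open>0 < Q t\<close> rho by simp
      then have "D \<le> - (d / ?n)"
        using d by (intro le_neg_divide_of_mult_le[OF _ card_argmax]) auto
      with D(1) show "\<exists>D\<le>- (d / ?n). (Q has_real_derivative D) (at t)" by blast
    qed blast
    then show False
      using Q_nonneg[of s] s(2)[of s] by linarith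
  qed
  moreover have D_ge: "Q t - q i t \<le> ?D t" for i t
  proof -
    have "Q t - q i t \<le> (\<Sum>i\<in>UNIV. Q t - q i t)"
      by (rule member_le_sum[of i UNIV "\<lambda>i. Q t - q i t"]) (use q_le_Q in auto)
    then show ?thesis by (simp add: sum_subtractf)
  qed
  moreover have "0 \<le> D'"
  proof (rule tendsto_lowerbound[OF D'])
    show "\<forall>\<^sub>F t in at_top. 0 \<le> ?D t"
      using qsum_le by simp
  qed simp
  ultimately have D0: "(?D \<longlongrightarrow> 0) at_top"
    using D' by simp
  have "(q i \<longlongrightarrow> c) at_top" for i
  proof (rule tendsto_sandwich)
    show "((\<lambda>t. Q t - ?D t) \<longlongrightarrow> c) at_top"
      using tendsto_diff[OF c(2) D0] by simp
    show "\<forall>\<^sub>F t in at_top. Q t - ?D t \<le> q i t"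
    proof (rule always_eventually, rule allI)
      show "Q t - ?D t \<le> q i t" for t
        using D_ge[of t i] by linarith
    qed
    show "\<forall>\<^sub>F t in at_top. q i t \<le> Q t"
      using q_le_Q by simp
  qed (rule c(2))
  with c(1) show thesis by (rule that)
qed

text \<open>
  The centred occupancy \<open>f i j\<close> is a fixed linear combination of \<open>x\<close>, the queues and the loads. Its
  part \<open>z\<close> coming from \<open>x\<close> satisfies \<open>z' = - m j * z + h\<close> with \<open>h\<close> vanishing at infinity, because
  the row sums of \<open>m j * f i j\<close> are the derivatives \<open>- x'\<close> and its column sums tend to \<open>0\<close>.
\<close>
lemma occ_tendsto:
  assumes load: "\<And>j. (load j \<longlongrightarrow> rho) at_top" and q: "\<And>i. (q i \<longlongrightarrow> c) at_top"
  shows "(occ i j \<longlongrightarrow> l i j / m j) at_top"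
proof -
  obtain A :: "'i \<Rightarrow> 'j \<Rightarrow> 'i \<Rightarrow> real" and B :: "'i \<Rightarrow> 'j \<Rightarrow> 'j \<Rightarrow> real"
    where "\<forall>z i j. supported_on E z \<longrightarrow>
      z i j = (\<Sum>k\<in>UNIV. A i j k * (\<Sum>j\<in>UNIV. z k j)) + (\<Sum>k\<in>UNIV. B i j k * (\<Sum>i\<in>UNIV. z i k))"
    using left_inverse by blast
  note AB = this[rule_format]
  define f where "f i j t = occ i j t - l i j / m j" for i j t
  define k where "k i = (\<Sum>j\<in>UNIV. l i j / m j)" for i
  \<comment> \<open>Queues and loads are kept out of \<open>z\<close>, as they are differentiable
    only almost everywhere; they go into \<open>p\<close>, which tends to 0. Subtracting the limit
    \<open>c\<close> and the equilibrium row total \<open>k\<close> centres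
    \<open>x\<close>.\<close>
  define z where "z t = (\<Sum>i'\<in>UNIV. A i j i' * (x i' t - c - k i'))" for t
  define p where "p t = (\<Sum>j'\<in>UNIV. B i j j' * (bet j' * (load j' t - rho))) -
      (\<Sum>i'\<in>UNIV. A i j i' * (q i' t - c))" for t
  \<comment> \<open>The first sum is the contribution of the column sums of
    \<open>m j * f i j\<close>; the last term corrects for replacing \<open>f i j\<close> by
    \<open>z\<close>.\<close>
  define h where "h t = (\<Sum>j'\<in>UNIV. B i j j' * (m j' * (bet j' * (load j' t - rho)))) - m j * p t" for t
  have f_supp: "supported_on E (\<lambda>i j. f i j t)" for t
    using occ_supported[of t] l_supported by (simp add: f_def supported_on_def)
  have f_row: "(\<Sum>j\<in>UNIV. f i j t) = x i t - q i t - k i" if "0 \<le> t" for i t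
    by (simp add: f_def k_def sum_subtractf occ_row[OF that])
  have f_col: "(\<Sum>i\<in>UNIV. f i j t) = bet j * (load j t - rho)" if "0 \<le> t" for j t
  proof -
    have "(\<Sum>i\<in>UNIV. l i j / m j) = bet j * rho"
      using l_col[of j] m_pos[of j] by (simp add: sum_divide_distrib[symmetric])
    then show ?thesis
      by (simp add: f_def sum_subtractf occ_col[OF that] right_diff_distrib)
  qed
  have f_eq: "f i j t = z t + p t" if t: "0 \<le> t" for t
  proof -
    have "f i j t = (\<Sum>i'\<in>UNIV. A i j i' * (x i' t - q i' t - k i')) +
        (\<Sum>j'\<in>UNIV. B i j j' * (bet j' * (load j' t - rho)))"
      using AB[OF f_supp[of t], where i = i and j = j] unfolding f_row[OF t] f_col[OF t] .
    also have "(\<Sum>i'\<in>UNIV. A i j i' * (x i' t - q i' t - k i')) =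
        z t - (\<Sum>i'\<in>UNIV. A i j i' * (q i' t - c))"
      unfolding z_def sum_subtractf[symmetric] by (intro sum.cong refl) (simp add: algebra_simps)
    finally show ?thesis by (simp add: p_def)
  qed
  have p: "(p \<longlongrightarrow> 0) at_top"
  proof -
    have "(p \<longlongrightarrow> (\<Sum>j'\<in>UNIV. B i j j' * (bet j' * (rho - rho))) - (\<Sum>i'\<in>UNIV. A i j i' * (c - c))) at_top"
      unfolding p_def by (intro tendsto_intros load q)
    then show ?thesis by simp
  qed
  have h: "(h \<longlongrightarrow> 0) at_top"
  proof -
    have "(h \<longlongrightarrow> (\<Sum>j'\<in>UNIV. B i j j' * (m j' * (bet j' * (rho - rho)))) - m j * 0) at_top"
      unfolding h_def by (intro tendsto_intros load p)
    then show ?thesis by simp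
  qed
  have ode: "(z has_real_derivative (- m j * z t + h t)) (at t)" if t: "0 < t" for t
  proof -
    have lam: "lam i' - (\<Sum>j\<in>UNIV. m j * occ i' j t) = - (\<Sum>j\<in>UNIV. m j * f i' j t)" for i'
    proof -
      have "(\<Sum>j\<in>UNIV. m j * f i' j t) = (\<Sum>j\<in>UNIV. m j * occ i' j t) - (\<Sum>j\<in>UNIV. l i' j)"
        unfolding sum_subtractf[symmetric]
        by (intro sum.cong refl) (use m_pos in \<open>simp add: f_def right_diff_distrib less_imp_neq[symmetric]\<close>)
      then show ?thesis by (simp add: l_row)
    qed
    have der: "(z has_real_derivative (\<Sum>i'\<in>UNIV. A i j i' * (lam i' - (\<Sum>j\<in>UNIV. m j * occ i' j t) - 0 - 0))) (at t)"
      unfolding z_def[abs_def] by (intro DERIV_sum DERIV_cmult DERIV_diff DERIV_const x_deriv t)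
    have eq: "(\<Sum>i'\<in>UNIV. A i j i' * (lam i' - (\<Sum>j\<in>UNIV. m j * occ i' j t) - 0 - 0)) =
        - (\<Sum>i'\<in>UNIV. A i j i' * (\<Sum>j\<in>UNIV. m j * f i' j t))"
      unfolding diff_0_right lam by (simp add: sum_negf)
    \<comment> \<open>The weighted matrix is again supported on \<open>E\<close>, so the same
      coefficients \<open>A\<close> and \<open>B\<close> represent it.\<close>
    have "m j * f i j t = (\<Sum>i'\<in>UNIV. A i j i' * (\<Sum>j\<in>UNIV. m j * f i' j t)) +
        (\<Sum>j'\<in>UNIV. B i j j' * (m j' * (bet j' * (load j' t - rho))))"
    proof -
      have "supported_on E (\<lambda>i j. m j * f i j t)"
        using f_supp[of t] by (simp add: supported_on_def)
      from AB[OF this, where i = i and j = j] show ?thesis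
        using t by (simp add: sum_distrib_left[symmetric] f_col)
    qed
    moreover have "m j * f i j t = m j * z t + m j * p t"
      using f_eq[of t] t by (simp add: distrib_left)
    ultimately have "- (\<Sum>i'\<in>UNIV. A i j i' * (\<Sum>j\<in>UNIV. m j * f i' j t)) = - m j * z t + h t"
      unfolding h_def by linarith
    then show ?thesis
      using der by (simp only: eq)
  qed
  have "\<exists>L. L-lipschitz_on {0..} (\<lambda>t. x i' t + (- c - k i'))" for i'
    by (intro lipschitz_on_add_ex lipschitz_on_const_ex lip_x)
  then have "\<exists>L. L-lipschitz_on {0..} z"
    unfolding z_def[abs_def] by (intro lipschitz_on_sum_ex lipschitz_on_cmult_ex) (simp add: algebra_simps)
  then have "(z \<longlongrightarrow> 0) at_top"
    using m_pos h ode by (rule tendsto_0_of_linear_ode)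
  then have "((\<lambda>t. z t + p t + l i j / m j) \<longlongrightarrow> 0 + 0 + l i j / m j) at_top"
    by (intro tendsto_intros p)
  moreover have "\<forall>\<^sub>F t in at_top. z t + p t + l i j / m j = occ i j t"
    using eventually_ge_at_top[of 0] by eventually_elim (simp add: f_eq[symmetric] f_def)
  ultimately show ?thesis
    using Lim_transform_eventually by force
qed

theorem converges_to_equilibrium:
  assumes rho: "rho \<le> 1"
  shows "\<exists>q_eq psi_eq. equilibrium_point mu l rho q_eq psi_eq \<and>
    (\<forall>i. (q i \<longlongrightarrow> q_eq i) at_top) \<and>
    (\<forall>(i, j)\<in>basic_activities l. (psi i j \<longlongrightarrow> psi_eq i j) at_top) \<and>
    (\<forall>j. (load j \<longlongrightarrow> rho) at_top)"
proof -
  obtain c where c: "0 \<le> c" "rho < 1 \<longrightarrow> c = 0" "\<And>i. (q i \<longlongrightarrow> c) at_top"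
  proof (cases "rho < 1")
    case True
    obtain s where s: "\<And>t i. s \<le> t \<Longrightarrow> q i t = 0"
      using queues_vanish[OF True] by metis
    have "(q i \<longlongrightarrow> 0) at_top" for i
    proof (rule tendsto_eventually)
      show "\<forall>\<^sub>F t in at_top. q i t = 0"
        using s by (auto simp: eventually_at_top_linorder)
    qed
    then show thesis by (intro that[of 0]) auto
  next
    case False
    with rho have "rho = 1" by simp
    then obtain c where "0 \<le> c" "\<And>i. (q i \<longlongrightarrow> c) at_top"
      using critical_queues_tendsto by blast
    then show thesis using False by (intro that[of c]) auto
  qed
  have "(psi i j \<longlongrightarrow> l i j / mu i j) at_top" if ij: "(i, j) \<in> E" for i j
  proof -
    have "occ i j = psi i j"
      using ij by (simp add: occ_def[abs_def])
    then show ?thesis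
      using occ_tendsto[OF load_tendsto[OF rho] c(3), of i j] mu_eq[OF ij] by simp
  qed
  moreover have "equilibrium_point mu l rho (\<lambda>i. c) (\<lambda>i j. l i j / mu i j)"
    using rho c by (auto simp: equilibrium_point_def)
  ultimately show ?thesis
    using c(3) load_tendsto[OF rho] unfolding E_eq
    by (intro exI[of _ "\<lambda>i. c"] exI[of _ "\<lambda>i j. l i j / mu i j"]) auto
qed

end

theorem (in pooled_network) globally_stable:
  assumes rho: "rho \<le> 1"
  shows "globally_stable lam bet mu l rho"
  unfolding globally_stable_def
proof (intro allI impI)
  fix a x q psi load
  assume "fluid_model (basic_activities l) lam bet mu a x q psi load"
  then interpret network_fluid_model lam bet mu l rho m E a x q psi load
    by unfold_locales (simp add: E_eq)
  show "\<exists>q_eq psi_eq. equilibrium_point mu l rho q_eq psi_eq \<and>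
    (\<forall>i. (q i \<longlongrightarrow> q_eq i) at_top) \<and>
    (\<forall>(i, j)\<in>basic_activities l. (psi i j \<longlongrightarrow> psi_eq i j) at_top) \<and>
    (\<forall>j. (load j \<longlongrightarrow> rho) at_top)"
    using rho by (rule converges_to_equilibrium)
qed

theorem theorem4p1:
  fixes lam :: "'i::finite \<Rightarrow> real" and bet :: "'j::finite \<Rightarrow> real"
    and mu l :: "'i \<Rightarrow> 'j \<Rightarrow> real" and rho :: real
  assumes "\<And>i. 0 < lam i" and "\<And>j. 0 < bet j" and "\<And>i j. 0 \<le> mu i j"
    and "complete_resource_pooling lam bet mu l rho"
    and "\<exists>m :: 'j \<Rightarrow> real. (\<forall>j. 0 < m j) \<and> (\<forall>(i, j)\<in>basic_activities l. mu i j = m j)"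
  shows "(rho < 1 \<longrightarrow> globally_stable lam bet mu l rho) \<and>
    (rho = 1 \<longrightarrow> globally_stable lam bet mu l rho) \<and>
    (rho < 1 \<longrightarrow> underload_stable (underload_matrix (basic_activities l) bet mu)) \<and>
    (rho = 1 \<longrightarrow> critical_stable (critical_matrix (basic_activities l) bet mu))"
proof -
  obtain m where "\<And>j. 0 < m j" "\<And>i j. (i, j) \<in> basic_activities l \<Longrightarrow> mu i j = m j"
    using assms(5) by blast
  then interpret pooled_network lam bet mu l rho m "basic_activities l"
    using assms by unfold_locales auto
  show ?thesis
    using globally_stable underload_stable critical_stable by (intro conjI impI) simp_all
qed

end
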